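(* Let $\alpha>\beta$ and $\tau>0$ be constants, and let $G_n\sim \mathrm{SBM}(n,\mu_1,\mu_2,\tau^2)$ with $\mu_1=\alpha\sqrt{\frac{\log n}{n}}$, $\mu_2=\beta\sqrt{\frac{\log n}{n}}$ and planted labeling $\sigma^*\in\Theta_n$, and assume in addition that the diagonal entries of the weighted adjacency matrix $A$ are i.i.d. $A_{ii}\sim N(\mu_1,\tau^2)$ (independent of the off-diagonal entries). Let $$B:=A-\frac{n(\mu_1+\mu_2)}{2}\,\frac{\mathbf 1_n}{\sqrt n}\frac{\mathbf 1_n^{\top}}{\sqrt n},$$ let $u_1$ be the eigenvector corresponding to the largest eigenvalue $\lambda_1$ of $B$, and let $\hat\sigma:=\mathrm{sign}(u_1)$ (entrywise sign). Let $\mathrm{SNR}=\frac{(\alpha-\beta)^2}{8\tau^2}$. If $\mathrm{SNR}>1$, then $\hat\sigma$ achieves exact recovery: $$\mathbb{P}\left[M(\hat\sigma,\sigma^* )=1\right]\to1\quad\text{as } n\to\infty .$$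
   Context: $n$ is even, $[n]=\{1,\dots,n\}$, $\mathbf 1_n=(1,\dots,1)^\top\in\mathbb R^n$, and $\Theta_n=\{\sigma\in\{\pm1\}^n:\sum_i\sigma_i=0\}$. Gaussian weighted stochastic block model $\mathrm{SBM}(n,\mu_1,\mu_2,\tau^2)$: given a planted (unobserved) labeling $\sigma^*\in\Theta_n$, the observed symmetric weighted adjacency matrix $A$ has, independently over unordered pairs $\{i,j\}$ with $i\ne j$, $A_{ij}=A_{ji}\sim N(\mu_1,\tau^2)$ if $\sigma^*_i=\sigma^*_j$ and $A_{ij}=A_{ji}\sim N(\mu_2,\tau^2)$ if $\sigma^*_i\neq\sigma^*_j$. (For this result the diagonal entries are as specified in the claim.) Agreement ratio: $M(\hat\sigma,\sigma)=\max\left(\frac1n\sum_{i=1}^n\mathbf 1_{\hat\sigma_i=\sigma_i},\ \frac1n\sum_{i=1}^n\mathbf 1_{-\hat\sigma_i=\sigma_i}\right)$. The eigenvector $u_1$ is normalized to unit length and its global sign is immaterial since $M$ is invariant under $\hat\sigma\mapsto-\hat\sigma$. *)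

theory Defs
  imports "HOL-Probability.Probability" "Jordan_Normal_Form.Spectral_Radius"
begin

hide_type (open) Finite_Cartesian_Product.vec
hide_const (open) Finite_Cartesian_Product.vec Finite_Cartesian_Product.vec_nth
no_notation Finite_Cartesian_Product.vec_nth (infixl "$" 90)
no_notation inner (infix "\<bullet>" 70)

text \<open>
  The dimension n must be able to tend to infinity, so vectors and matrices carry their
  dimension as a value and the index set {1, ..., n} becomes {0, ..., n - 1}.
\<close>

definition balanced_labelings :: "nat \<Rightarrow> real vec set" where
  "balanced_labelings n =
     {\<sigma> \<in> carrier_vec n. (\<forall>i<n. \<sigma> $ i \<in> {1, -1}) \<and> (\<Sum>i<n. \<sigma> $ i) = 0}"

text \<open>
  Only off-diagonal entries are constrained; independence over unordered pairs of
  distinct vertices is independence of the entries above the diagonal.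
\<close>

definition gaussian_sbm ::
  "'a measure \<Rightarrow> nat \<Rightarrow> real \<Rightarrow> real \<Rightarrow> real \<Rightarrow> real vec \<Rightarrow> ('a \<Rightarrow> real mat) \<Rightarrow> bool" where
  "gaussian_sbm P n \<mu>\<^sub>1 \<mu>\<^sub>2 \<tau> \<sigma> A \<longleftrightarrow>
     prob_space P \<and> \<sigma> \<in> balanced_labelings n \<and>
     (\<forall>\<omega>\<in>space P. A \<omega> \<in> carrier_mat n n \<and> transpose_mat (A \<omega>) = A \<omega>) \<and>
     (\<forall>i<n. \<forall>j<n. i \<noteq> j \<longrightarrow>
        distributed P lborel (\<lambda>\<omega>. A \<omega> $$ (i, j))
          (\<lambda>x. ennreal (normal_density (if \<sigma> $ i = \<sigma> $ j then \<mu>\<^sub>1 else \<mu>\<^sub>2) \<tau> x))) \<and>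
     prob_space.indep_vars P (\<lambda>_. borel) (\<lambda>(i, j) \<omega>. A \<omega> $$ (i, j)) {(i, j). i < j \<and> j < n}"

text \<open>
  For the diagonal: independence of the whole family on and above the diagonal is
  equivalent to the diagonal entries being independent and, jointly, independent of the
  (mutually independent) off-diagonal ones.
\<close>

definition gaussian_sbm_diag ::
  "'a measure \<Rightarrow> nat \<Rightarrow> real \<Rightarrow> real \<Rightarrow> real \<Rightarrow> real vec \<Rightarrow> ('a \<Rightarrow> real mat) \<Rightarrow> bool" where
  "gaussian_sbm_diag P n \<mu>\<^sub>1 \<mu>\<^sub>2 \<tau> \<sigma> A \<longleftrightarrow>
     gaussian_sbm P n \<mu>\<^sub>1 \<mu>\<^sub>2 \<tau> \<sigma> A \<and>
     (\<forall>i<n. distributed P lborel (\<lambda>\<omega>. A \<omega> $$ (i, i))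
              (\<lambda>x. ennreal (normal_density \<mu>\<^sub>1 \<tau> x))) \<and>
     prob_space.indep_vars P (\<lambda>_. borel) (\<lambda>(i, j) \<omega>. A \<omega> $$ (i, j)) {(i, j). i \<le> j \<and> j < n}"

definition edge_mean :: "real \<Rightarrow> nat \<Rightarrow> real" where
  "edge_mean a n = a * sqrt (ln (real n) / real n)"

definition normalized_ones :: "nat \<Rightarrow> real vec" where
  "normalized_ones n = (1 / sqrt (real n)) \<cdot>\<^sub>v vec n (\<lambda>_. 1)"

definition outer_product :: "real vec \<Rightarrow> real vec \<Rightarrow> real mat" where
  "outer_product u v = mat (dim_vec u) (dim_vec v) (\<lambda>(i, j). u $ i * v $ j)"

definition centered_adjacency :: "nat \<Rightarrow> real \<Rightarrow> real \<Rightarrow> real mat \<Rightarrow> real mat" where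
  "centered_adjacency n \<mu>\<^sub>1 \<mu>\<^sub>2 A =
     A - (real n * (\<mu>\<^sub>1 + \<mu>\<^sub>2) / 2) \<cdot>\<^sub>m outer_product (normalized_ones n) (normalized_ones n)"

definition largest_eigenvalue :: "real mat \<Rightarrow> real" where
  "largest_eigenvalue B = Max (spectrum B)"

definition top_unit_eigenvector :: "real mat \<Rightarrow> real vec \<Rightarrow> bool" where
  "top_unit_eigenvector B u \<longleftrightarrow> eigenvector B u (largest_eigenvalue B) \<and> u \<bullet> u = 1"

text \<open>
  Convention: the sign of 0 is 0, so a vanishing entry of the eigenvector never agrees
  with a label.
\<close>

definition sign_vec :: "real vec \<Rightarrow> real vec" where
  "sign_vec u = map_vec sgn u"

definition agreement_ratio :: "nat \<Rightarrow> real vec \<Rightarrow> real vec \<Rightarrow> real" where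
  "agreement_ratio n \<sigma>' \<sigma> =
     max (1 / real n * (\<Sum>i<n. of_bool (\<sigma>' $ i = \<sigma> $ i)))
         (1 / real n * (\<Sum>i<n. of_bool (- \<sigma>' $ i = \<sigma> $ i)))"

end

theory Submission
  imports Defs "HOL-Real_Asymp.Real_Asymp"
begin

text \<open>
  Let \<open>\<gamma> = (\<mu>\<^sub>1 - \<mu>\<^sub>2) / 2\<close> and let \<open>W\<close> be the matrix of centred entries of \<open>A\<close>. Because the
  diagonal of \<open>A\<close> has mean \<open>\<mu>\<^sub>1\<close>, the centred adjacency matrix is exactly a rank-one spike plus
  symmetric Gaussian noise, \<open>B = \<gamma> \<sigma> \<sigma>\<^sup>T + W\<close>, and its leading eigenpair satisfies
  \<open>(\<lambda> - W) u = c \<sigma>\<close> with \<open>c = \<gamma> \<langle>\<sigma>, u\<rangle>\<close>. Hence \<open>u\<close> is proportional to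
  \<open>\<sigma> + W \<sigma> / \<lambda> + W\<^sup>2 \<sigma> / \<lambda>\<^sup>2 + \<dots>\<close>, where \<open>\<lambda>\<close> is about \<open>n \<gamma> = \<kappa> \<surd>(n ln n)\<close> with
  \<open>\<kappa> = (\<alpha> - \<beta>) / 2\<close>. The \<open>i\<close>-th entry of \<open>W \<sigma> / \<lambda>\<close> is Gaussian and cancels the entry of \<open>\<sigma>\<close>
  with probability about \<open>n\<close> to the power \<open>- \<kappa>\<^sup>2 / (2 \<tau>\<^sup>2)\<close>, and \<open>\<kappa>\<^sup>2 / (2 \<tau>\<^sup>2)\<close> is the
  signal-to-noise ratio. When it exceeds 1, a union bound over the \<open>n\<close> entries shows that no entry
  changes its sign through this term.

  The remaining terms must be \<open>o(1)\<close> in every entry at once. The operator norm of \<open>W\<close> is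
  \<open>O(\<surd>n)\<close>, which controls them only in Euclidean norm. The entrywise bound comes from leaving out
  one vertex: let \<open>r\<close> be row \<open>i\<close> of \<open>W\<close> without its diagonal entry, and \<open>N\<close> the matrix \<open>W\<close> with
  row and column \<open>i\<close> cleared. The Schur complement formula for \<open>\<lambda> - W\<close>, truncated after \<open>K\<close>
  terms of the Neumann series (\<open>leave_one_out_identity\<close>), reads
  \<open>D u\<^sub>i = c (\<sigma>\<^sub>i + \<Sum>k<K. \<langle>r, N\<^sup>k \<sigma>\<rangle> / \<lambda>\<^sup>k\<^sup>+\<^sup>1) + error\<close> with \<open>D > 0\<close> and an error of order
  \<open>4\<^sup>-\<^sup>K \<lambda>\<close>. Since \<open>N\<close> is independent of \<open>r\<close>, each \<open>\<langle>r, N\<^sup>k \<sigma>\<rangle>\<close> is conditionally Gaussian with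
  standard deviation at most \<open>\<tau> \<rho>\<^sup>k \<surd>n\<close>, where \<open>\<rho>\<close> bounds the norm of \<open>W\<close>
  (\<open>gaussian_sum_tail_random_coefficients\<close>). The eigenvalue \<open>\<lambda>\<close> does depend on \<open>r\<close>, but it
  occurs only in the scalar factors, so one union bound over \<open>i\<close> and \<open>k\<close> serves all its values.
  The terms with \<open>k \<ge> 1\<close> then sum to \<open>O(1 / \<surd>(ln n))\<close>.

  Two more facts complete the argument: \<open>\<lambda> \<ge> n \<gamma> - \<rho>\<close> by comparing with the Rayleigh quotient of
  \<open>\<sigma>\<close> (\<open>rayleigh_le_largest_eigenvalue\<close>), and \<open>\<rho> = 24 \<tau> \<surd>n\<close> with high probability by a union
  bound over a lattice net of the unit ball (\<open>operator_norm_event\<close>).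
\<close>

section \<open>Vectors and matrices below a dimension\<close>

text \<open>
  The dimension is an ordinary argument: a vector is a function on the natural numbers of which
  only the values below \<open>n\<close> matter, and the powers of a matrix act by iterating \<open>mv n M\<close>.
\<close>

definition ip :: "nat \<Rightarrow> (nat \<Rightarrow> real) \<Rightarrow> (nat \<Rightarrow> real) \<Rightarrow> real" where
  "ip n x y = (\<Sum>i<n. x i * y i)"

definition nrm :: "nat \<Rightarrow> (nat \<Rightarrow> real) \<Rightarrow> real" where
  "nrm n x = L2_set x {..<n}"

definition mv :: "nat \<Rightarrow> (nat \<Rightarrow> nat \<Rightarrow> real) \<Rightarrow> (nat \<Rightarrow> real) \<Rightarrow> nat \<Rightarrow> real" where
  "mv n M x i = (\<Sum>j<n. M i j * x j)"

definition symmetric_below :: "nat \<Rightarrow> (nat \<Rightarrow> nat \<Rightarrow> real) \<Rightarrow> bool" where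
  "symmetric_below n M \<longleftrightarrow> (\<forall>i<n. \<forall>j<n. M i j = M j i)"

text \<open>
  The operator norm is at most \<open>\<rho>\<close>. Stated through the bilinear form, the bound passes directly
  to submatrices and can be tested on pairs of points of a net.
\<close>

definition form_bounded :: "nat \<Rightarrow> (nat \<Rightarrow> nat \<Rightarrow> real) \<Rightarrow> real \<Rightarrow> bool" where
  "form_bounded n M \<rho> \<longleftrightarrow> (\<forall>x y. \<bar>ip n x (mv n M y)\<bar> \<le> \<rho> * nrm n x * nrm n y)"

definition unit_at :: "nat \<Rightarrow> nat \<Rightarrow> real" where
  "unit_at i j = of_bool (j = i)"

definition off_diag_row :: "(nat \<Rightarrow> nat \<Rightarrow> real) \<Rightarrow> nat \<Rightarrow> nat \<Rightarrow> real" where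
  "off_diag_row M i j = (if j = i then 0 else M i j)"

text \<open>
  Clearing row and column \<open>i\<close>, instead of deleting them, keeps all indices in place.
\<close>

definition leave_out :: "(nat \<Rightarrow> nat \<Rightarrow> real) \<Rightarrow> nat \<Rightarrow> nat \<Rightarrow> nat \<Rightarrow> real" where
  "leave_out M i a b = (if a = i \<or> b = i then 0 else M a b)"

lemma ip_commute: "ip n x y = ip n y x"
  by (simp add: ip_def mult.commute)

lemma ip_cong: "(\<And>i. i < n \<Longrightarrow> x i = x' i) \<Longrightarrow> (\<And>i. i < n \<Longrightarrow> y i = y' i) \<Longrightarrow> ip n x y = ip n x' y'"
  by (simp add: ip_def)

lemma mv_cong: "(\<And>i. i < n \<Longrightarrow> x i = x' i) \<Longrightarrow> mv n M x = mv n M x'"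
  by (simp add: mv_def fun_eq_iff)

lemma ip_add_right: "ip n x (\<lambda>i. y i + z i) = ip n x y + ip n x z"
  by (simp add: ip_def algebra_simps sum.distrib)

lemma ip_diff_right: "ip n x (\<lambda>i. y i - z i) = ip n x y - ip n x z"
  by (simp add: ip_def algebra_simps sum_subtractf)

lemma ip_scale_right: "ip n x (\<lambda>i. c * y i) = c * ip n x y"
  by (simp add: ip_def sum_distrib_left mult.left_commute)

lemma ip_sum_right: "ip n x (\<lambda>i. \<Sum>k\<in>S. y k i) = (\<Sum>k\<in>S. ip n x (y k))"
proof -
  have "ip n x (\<lambda>i. \<Sum>k\<in>S. y k i) = (\<Sum>i<n. \<Sum>k\<in>S. x i * y k i)"
    by (simp add: ip_def sum_distrib_left)
  also have "\<dots> = (\<Sum>k\<in>S. \<Sum>i<n. x i * y k i)" by (rule sum.swap)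
  finally show ?thesis by (simp add: ip_def)
qed

lemma mv_add: "mv n M (\<lambda>i. x i + y i) i = mv n M x i + mv n M y i"
  by (simp add: mv_def algebra_simps sum.distrib)

lemma mv_diff: "mv n M (\<lambda>i. x i - y i) i = mv n M x i - mv n M y i"
  by (simp add: mv_def algebra_simps sum_subtractf)

lemma mv_scale: "mv n M (\<lambda>i. c * x i) i = c * mv n M x i"
  by (simp add: mv_def sum_distrib_left mult.left_commute)

lemma mv_sum: "mv n M (\<lambda>j. \<Sum>k\<in>S. y k j) i = (\<Sum>k\<in>S. mv n M (y k) i)"
proof -
  have "mv n M (\<lambda>j. \<Sum>k\<in>S. y k j) i = (\<Sum>j<n. \<Sum>k\<in>S. M i j * y k j)"
    by (simp add: mv_def sum_distrib_left)
  also have "\<dots> = (\<Sum>k\<in>S. \<Sum>j<n. M i j * y k j)" by (rule sum.swap)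
  finally show ?thesis by (simp add: mv_def)
qed

lemma ip_self: "ip n x x = (nrm n x)\<^sup>2"
  by (simp add: ip_def nrm_def L2_set_def sum_nonneg power2_eq_square)

lemma nrm_nonneg [simp]: "0 \<le> nrm n x"
  by (simp add: nrm_def)

lemma abs_ip_le: "\<bar>ip n x y\<bar> \<le> nrm n x * nrm n y"
proof -
  have "\<bar>ip n x y\<bar> \<le> (\<Sum>i<n. \<bar>x i\<bar> * \<bar>y i\<bar>)"
    unfolding ip_def using sum_abs[of "\<lambda>i. x i * y i" "{..<n}"] by (simp add: abs_mult)
  also have "\<dots> \<le> nrm n x * nrm n y"
    unfolding nrm_def by (rule L2_set_mult_ineq)
  finally show ?thesis .
qed

lemma nrm_scale: "nrm n (\<lambda>i. c * x i) = \<bar>c\<bar> * nrm n x"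
  by (simp add: nrm_def L2_set_def power_mult_distrib sum_distrib_left[symmetric] real_sqrt_mult)

lemma nrm_le_of_abs_le: "(\<And>i. i < n \<Longrightarrow> \<bar>x i\<bar> \<le> \<bar>y i\<bar>) \<Longrightarrow> nrm n x \<le> nrm n y"
  unfolding nrm_def L2_set_def
  by (intro real_sqrt_le_mono sum_mono) (auto simp: abs_le_square_iff)

lemma nrm_sign: "(\<And>i. i < n \<Longrightarrow> \<sigma> i \<in> {1, -1}) \<Longrightarrow> nrm n \<sigma> = sqrt n"
proof -
  assume *: "\<And>i. i < n \<Longrightarrow> \<sigma> i \<in> {1, -1}"
  have "(\<Sum>i<n. (\<sigma> i)\<^sup>2) = (\<Sum>i<n. 1)"
    by (rule sum.cong) (use * in fastforce)+
  then show ?thesis by (simp add: nrm_def L2_set_def)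
qed

lemma ip_unit_at: "i < n \<Longrightarrow> ip n x (unit_at i) = x i"
  unfolding ip_def unit_at_def by (simp add: of_bool_def if_distrib cong: if_cong)

lemma mv_unit_at: "i < n \<Longrightarrow> mv n M (unit_at i) a = M a i"
  unfolding mv_def unit_at_def by (simp add: of_bool_def if_distrib cong: if_cong)

lemma nrm_unit_at: "i < n \<Longrightarrow> nrm n (unit_at i) = 1"
  using ip_self[of n "unit_at i"] ip_unit_at[of i n "unit_at i"]
  by (simp add: unit_at_def) (smt (verit) nrm_nonneg power2_eq_1_iff)

lemma ip_mv_symmetric:
  assumes "symmetric_below n M"
  shows "ip n x (mv n M y) = ip n (mv n M x) y"
proof -
  have "ip n x (mv n M y) = (\<Sum>i<n. \<Sum>j<n. x i * (M i j * y j))"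
    by (simp add: ip_def mv_def sum_distrib_left)
  also have "\<dots> = (\<Sum>j<n. \<Sum>i<n. x i * (M i j * y j))" by (rule sum.swap)
  also have "\<dots> = (\<Sum>j<n. \<Sum>i<n. M j i * x i * y j)"
    using assms by (intro sum.cong refl) (auto simp: symmetric_below_def)
  also have "\<dots> = ip n (mv n M x) y"
    by (simp add: ip_def mv_def sum_distrib_right)
  finally show ?thesis .
qed

lemma ip_mv_power_symmetric:
  assumes "symmetric_below n M"
  shows "ip n x ((mv n M ^^ k) y) = ip n ((mv n M ^^ k) x) y"
proof (induction k arbitrary: x)
  case (Suc k)
  have "ip n x ((mv n M ^^ Suc k) y) = ip n (mv n M x) ((mv n M ^^ k) y)"
    using ip_mv_symmetric[OF assms] by simp
  also have "\<dots> = ip n ((mv n M ^^ Suc k) x) y"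
    using Suc by (simp add: funpow_swap1)
  finally show ?case .
qed simp

lemma nrm_mv_le:
  assumes "form_bounded n M \<rho>"
  shows "nrm n (mv n M x) \<le> \<rho> * nrm n x"
proof (cases "nrm n (mv n M x) = 0")
  case True
  show ?thesis
  proof (cases "n = 0")
    case True then show ?thesis by (simp add: nrm_def L2_set_def)
  next
    case False
    have "\<bar>ip n (unit_at 0) (mv n M (unit_at 0))\<bar> \<le> \<rho> * nrm n (unit_at 0) * nrm n (unit_at 0)"
      using assms unfolding form_bounded_def by blast
    then have "0 \<le> \<rho>" using False nrm_unit_at[of 0 n] by simp
    then show ?thesis using True by simp
  qed
next
  case False
  let ?y = "mv n M x"
  have "(nrm n ?y)\<^sup>2 \<le> \<rho> * nrm n ?y * nrm n x"
    using assms unfolding form_bounded_def ip_self[symmetric] by (meson abs_le_D1)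
  then have "nrm n ?y * nrm n ?y \<le> nrm n ?y * (\<rho> * nrm n x)"
    by (simp add: power2_eq_square algebra_simps)
  then show ?thesis
    using False nrm_nonneg[of n ?y] by (simp add: mult_le_cancel_left)
qed

lemma nrm_mv_power_le:
  assumes "form_bounded n M \<rho>" "0 \<le> \<rho>"
  shows "nrm n ((mv n M ^^ k) x) \<le> \<rho> ^ k * nrm n x"
proof (induction k)
  case (Suc k)
  have "nrm n ((mv n M ^^ Suc k) x) \<le> \<rho> * nrm n ((mv n M ^^ k) x)"
    using nrm_mv_le[OF assms(1)] by simp
  also have "\<dots> \<le> \<rho> * (\<rho> ^ k * nrm n x)"
    using Suc assms(2) by (intro mult_left_mono)
  finally show ?case by simp
qed simp

lemma mv_power_uminus: "(mv n N ^^ k) (\<lambda>j. - v j) = (\<lambda>j. - (mv n N ^^ k) v j)"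
  by (induction k) (auto simp: mv_def sum_negf)

lemma symmetric_below_leave_out: "symmetric_below n M \<Longrightarrow> symmetric_below n (leave_out M i)"
  by (auto simp: symmetric_below_def leave_out_def)

text \<open>
  The form of the cleared matrix is the form of \<open>M\<close> on vectors whose \<open>i\<close>-th entry is set to zero,
  which only shortens them.
\<close>

lemma form_bounded_leave_out:
  assumes "form_bounded n M \<rho>" "0 \<le> \<rho>"
  shows "form_bounded n (leave_out M i) \<rho>"
  unfolding form_bounded_def
proof (intro allI)
  fix x y :: "nat \<Rightarrow> real"
  let ?x = "\<lambda>j. if j = i then 0 else x j" and ?y = "\<lambda>j. if j = i then 0 else y j"
  have "mv n (leave_out M i) y j = (if j = i then 0 else mv n M ?y j)" for j
    unfolding mv_def leave_out_def by (auto intro!: sum.cong)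
  then have "ip n x (mv n (leave_out M i) y) = ip n ?x (mv n M ?y)"
    unfolding ip_def by (auto intro!: sum.cong)
  then have "\<bar>ip n x (mv n (leave_out M i) y)\<bar> \<le> \<rho> * nrm n ?x * nrm n ?y"
    using assms(1) by (simp add: form_bounded_def)
  also have "\<dots> \<le> \<rho> * nrm n x * nrm n y"
    using assms(2) by (intro mult_mono mult_left_mono nrm_le_of_abs_le) (auto intro!: mult_nonneg_nonneg)
  finally show "\<bar>ip n x (mv n (leave_out M i) y)\<bar> \<le> \<rho> * nrm n x * nrm n y" .
qed

lemma entry_le_of_form_bounded:
  assumes "form_bounded n M \<rho>" "i < n"
  shows "\<bar>M i i\<bar> \<le> \<rho>"
proof -
  have "\<bar>ip n (unit_at i) (mv n M (unit_at i))\<bar> \<le> \<rho> * nrm n (unit_at i) * nrm n (unit_at i)"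
    using assms(1) by (simp add: form_bounded_def)
  moreover have "ip n (unit_at i) (mv n M (unit_at i)) = M i i"
    using assms(2) by (subst ip_commute) (simp add: ip_unit_at mv_unit_at)
  ultimately show ?thesis using assms(2) by (simp add: nrm_unit_at)
qed

text \<open>
  The row is, up to its diagonal entry, the image of a unit vector.
\<close>

lemma nrm_off_diag_row_le:
  assumes "symmetric_below n M" "form_bounded n M \<rho>" "i < n"
  shows "nrm n (off_diag_row M i) \<le> \<rho>"
proof -
  have "nrm n (off_diag_row M i) \<le> nrm n (mv n M (unit_at i))"
    using assms by (intro nrm_le_of_abs_le) (auto simp: off_diag_row_def mv_unit_at symmetric_below_def)
  also have "\<dots> \<le> \<rho>"
    using nrm_mv_le[OF assms(2), of "unit_at i"] assms(3) by (simp add: nrm_unit_at)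
  finally show ?thesis .
qed

section \<open>Entrywise signs of the leading eigenvector\<close>

text \<open>
  Applied to the ratio \<open>\<rho> / \<lambda>\<close> of noise to leading eigenvalue, which tends to zero: the tail of the
  Neumann series is then of the order of its first term.
\<close>

lemma geometric_quarter_le:
  fixes q :: real
  assumes "0 \<le> q" "q \<le> 1/4"
  shows "(\<Sum>k<K. q ^ Suc k) \<le> 2 * q"
proof -
  have "(\<Sum>k<K. q ^ k) = (1 - q ^ K) / (1 - q)"
    using assms by (subst sum_gp_strict) auto
  also have "\<dots> \<le> 1 / (1 - q)"
    using assms by (intro divide_right_mono) auto
  also have "\<dots> \<le> 2" using assms by (simp add: field_simps)
  finally have "q * (\<Sum>k<K. q ^ k) \<le> q * 2" using assms by (intro mult_left_mono) auto
  then show ?thesis by (simp add: sum_distrib_left)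
qed

text \<open>
  Let \<open>y\<close> be the truncated Neumann series for \<open>(\<lambda> - N)\<^sup>-\<^sup>1 r\<close>. It vanishes at \<open>i\<close>, and
  \<open>z = e\<^sub>i + y\<close> approximates a multiple of column \<open>i\<close> of \<open>(\<lambda> - W)\<^sup>-\<^sup>1\<close>: the vector
  \<open>(\<lambda> - W) z\<close> is \<open>D e\<^sub>i\<close> up to the truncation error \<open>N\<^sup>K r / \<lambda>\<^sup>K\<close>, with \<open>D\<close> the truncated Schur
  complement. Pairing it with \<open>u\<close> and moving \<open>\<lambda> - W\<close> to the other side by symmetry gives
  the identity. In the sum on the right-hand side the powers of \<open>N\<close> have been moved from \<open>r\<close> to
  \<open>\<sigma>\<close>, so that \<open>r\<close> enters linearly; this is what makes each term conditionally Gaussian.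
\<close>

lemma leave_one_out_identity:
  fixes W :: "nat \<Rightarrow> nat \<Rightarrow> real" and K :: nat
  defines "r \<equiv> off_diag_row W" and "N \<equiv> leave_out W"
  assumes sym: "symmetric_below n W" and i: "i < n" and lam: "lam \<noteq> 0"
    and eig: "\<And>a. a < n \<Longrightarrow> lam * u a - mv n W u a = c * \<sigma> a"
  shows "(lam - W i i - (\<Sum>k<K. ip n (r i) ((mv n (N i) ^^ k) (r i)) / lam ^ Suc k)) * u i
           - ip n u ((mv n (N i) ^^ K) (r i)) / lam ^ K
         = c * (\<sigma> i + (\<Sum>k<K. ip n (r i) ((mv n (N i) ^^ k) \<sigma>) / lam ^ Suc k))"
proof -
  define p where "p k = (mv n (N i) ^^ k) (r i)" for k
  define y where "y j = (\<Sum>k<K. (1 / lam ^ Suc k) * p k j)" for j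
  define z where "z j = unit_at i j + y j" for j
  define D where "D = lam - W i i - ip n (r i) y"
  have symN: "symmetric_below n (N i)" unfolding N_def by (rule symmetric_below_leave_out[OF sym])
  have p_Suc: "p (Suc k) = mv n (N i) (p k)" for k by (simp add: p_def)
  have p_i: "p k i = 0" for k
    by (cases k) (auto simp: p_def r_def off_diag_row_def mv_def N_def leave_out_def)
  have y_i: "y i = 0" by (simp add: y_def p_i)
  \<comment> \<open>\<open>(\<lambda> - N) y = r - N\<^sup>K r / \<lambda>\<^sup>K\<close>\<close>
  have telescope: "lam * y a - mv n (N i) y a = r i a - p K a / lam ^ K" for a
  proof -
    have "mv n (N i) y a = (\<Sum>k<K. (1 / lam ^ Suc k) * p (Suc k) a)"
      unfolding y_def mv_sum mv_scale p_Suc ..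
    moreover have "lam * y a = (\<Sum>k<K. p k a / lam ^ k)"
      unfolding y_def sum_distrib_left using lam by (intro sum.cong) auto
    ultimately have "lam * y a - mv n (N i) y a = (\<Sum>k<K. p k a / lam ^ k - p (Suc k) a / lam ^ Suc k)"
      by (simp add: sum_subtractf)
    also have "\<dots> = p 0 a / lam ^ 0 - p K a / lam ^ K"
      using sum_lessThan_telescope'[of "\<lambda>k. p k a / lam ^ k" K] by simp
    finally show ?thesis by (simp add: p_def)
  qed
  have column: "lam * z a - mv n W z a = D * unit_at i a - p K a / lam ^ K" if a: "a < n" for a
  proof (cases "a = i")
    case True
    have "mv n W z i = W i i + mv n W y i"
      unfolding z_def mv_add using i by (simp add: mv_unit_at)
    moreover have "mv n W y i = ip n (r i) y"
      unfolding mv_def ip_def r_def off_diag_row_def by (intro sum.cong) (auto simp: y_i)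
    ultimately show ?thesis using True by (simp add: D_def p_i z_def y_i unit_at_def algebra_simps)
  next
    case False
    have "mv n W z a = W a i + mv n W y a"
      unfolding z_def mv_add using i by (simp add: mv_unit_at)
    moreover have "mv n W y a = mv n (N i) y a"
      unfolding mv_def N_def leave_out_def using False by (intro sum.cong) (auto simp: y_i)
    moreover have "W a i = r i a"
      using sym a i False by (auto simp: r_def off_diag_row_def symmetric_below_def)
    ultimately show ?thesis using False telescope[of a] by (simp add: z_def unit_at_def)
  qed
  have "ip n u (\<lambda>a. lam * z a - mv n W z a) = ip n (\<lambda>a. lam * u a - mv n W u a) z"
    using ip_mv_symmetric[OF sym, of u z]
    by (simp add: ip_diff_right ip_scale_right ip_commute[of n "\<lambda>a. _ a - _ a" z] ip_commute[of n z u])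
       (simp add: ip_commute)
  also have "\<dots> = ip n (\<lambda>a. c * \<sigma> a) z" by (rule ip_cong) (auto simp: eig)
  also have "\<dots> = c * (ip n \<sigma> z)" by (simp add: ip_commute[of n _ z] ip_scale_right)
  also have "ip n \<sigma> z = \<sigma> i + ip n \<sigma> y"
    unfolding z_def ip_add_right using i by (simp add: ip_unit_at)
  finally have "ip n u (\<lambda>a. D * unit_at i a - p K a / lam ^ K) = c * (\<sigma> i + ip n \<sigma> y)"
    using ip_cong[of n u u "\<lambda>a. lam * z a - mv n W z a" "\<lambda>a. D * unit_at i a - p K a / lam ^ K"]
      column by simp
  moreover have "ip n u (\<lambda>a. D * unit_at i a - p K a / lam ^ K) = D * u i - ip n u (p K) / lam ^ K"
    using ip_scale_right[of n u "1 / lam ^ K" "p K"] i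
    by (simp add: ip_diff_right ip_scale_right ip_unit_at)
  moreover have "ip n x y = (\<Sum>k<K. ip n x (p k) / lam ^ Suc k)" for x
    unfolding y_def ip_sum_right ip_scale_right by simp
  moreover have "ip n \<sigma> (p k) = ip n (r i) ((mv n (N i) ^^ k) \<sigma>)" for k
    unfolding p_def by (subst ip_mv_power_symmetric[OF symN]) (rule ip_commute)
  ultimately show ?thesis unfolding D_def p_def by simp
qed

text \<open>
  In the leave-one-out identity \<open>D\<close> is positive as soon as \<open>\<lambda>\<close> dominates the norm of \<open>W\<close>, so
  \<open>u i\<close> has the sign of \<open>c\<close> times the bracket. The assumption \<open>row\<close> says that the bracket has
  the sign of \<open>\<sigma> i\<close> with margin \<open>\<eta>\<close>. The truncation error is harmless because
  \<open>\<bar>c\<bar> * sqrt n\<close>, the length of \<open>(\<lambda> - W) u\<close>, is at least \<open>\<lambda> / 2\<close>.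
\<close>

lemma eigenvector_signs:
  fixes W :: "nat \<Rightarrow> nat \<Rightarrow> real" and K :: nat
  assumes sym: "symmetric_below n W" and bd: "form_bounded n W \<rho>"
    and rho: "0 \<le> \<rho>" "4 * \<rho> \<le> lam" and lam: "0 < lam"
    and sig: "\<And>i. i < n \<Longrightarrow> \<sigma> i \<in> {1, -1}"
    and unit: "ip n u u = 1"
    and eig: "\<And>i. i < n \<Longrightarrow> lam * u i - mv n W u i = c * \<sigma> i"
    and row: "\<And>i. i < n \<Longrightarrow>
      \<eta> \<le> 1 + \<sigma> i * (\<Sum>k<K. ip n (off_diag_row W i) ((mv n (leave_out W i) ^^ k) \<sigma>) / lam ^ Suc k)"
    and eta: "(1/4) ^ K * sqrt n < \<eta>"
    and i: "i < n"
  shows "0 < c * \<sigma> i * u i"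
proof -
  define r where "r = off_diag_row W i"
  define N where "N = leave_out W i"
  define S where "S = (\<Sum>k<K. ip n r ((mv n N ^^ k) \<sigma>) / lam ^ Suc k)"
  define T where "T = (\<Sum>k<K. ip n r ((mv n N ^^ k) r) / lam ^ Suc k)"
  define D where "D = lam - W i i - T"
  define e where "e = ip n u ((mv n N ^^ K) r) / lam ^ K"
  have id: "D * u i - e = c * (\<sigma> i + S)"
    unfolding D_def e_def S_def T_def r_def N_def
    by (rule leave_one_out_identity[OF sym i _ eig]) (use lam in auto)
  have bdN: "form_bounded n N \<rho>" unfolding N_def by (rule form_bounded_leave_out[OF bd rho(1)])
  have r: "nrm n r \<le> \<rho>" unfolding r_def by (rule nrm_off_diag_row_le[OF sym bd i])
  have nu: "nrm n u = 1" using unit by (simp add: ip_self) (smt (verit) nrm_nonneg power2_eq_1_iff)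
  have q: "0 \<le> \<rho> / lam" "\<rho> / lam \<le> 1/4" using rho lam by (auto simp: field_simps)
  have pw: "\<bar>ip n x ((mv n N ^^ k) r)\<bar> \<le> nrm n x * (\<rho> ^ k * \<rho>)" for x k
  proof -
    have "\<bar>ip n x ((mv n N ^^ k) r)\<bar> \<le> nrm n x * nrm n ((mv n N ^^ k) r)" by (rule abs_ip_le)
    also have "\<dots> \<le> nrm n x * (\<rho> ^ k * nrm n r)"
      by (intro mult_left_mono nrm_mv_power_le[OF bdN rho(1)]) auto
    also have "\<dots> \<le> nrm n x * (\<rho> ^ k * \<rho>)"
      using r rho by (intro mult_left_mono) auto
    finally show ?thesis .
  qed
  have "\<bar>T\<bar> \<le> (\<Sum>k<K. \<bar>ip n r ((mv n N ^^ k) r) / lam ^ Suc k\<bar>)" unfolding T_def by (rule sum_abs)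
  also have "\<dots> \<le> (\<Sum>k<K. \<rho> * (\<rho> / lam) ^ Suc k)"
  proof (rule sum_mono)
    fix k
    have "\<bar>ip n r ((mv n N ^^ k) r)\<bar> \<le> \<rho> * (\<rho> ^ k * \<rho>)"
      using pw[of r k] r rho(1) mult_right_mono[of "nrm n r" \<rho> "\<rho> ^ k * \<rho>"] by auto
    then have "\<bar>ip n r ((mv n N ^^ k) r)\<bar> / lam ^ Suc k \<le> \<rho> * (\<rho> ^ k * \<rho>) / lam ^ Suc k"
      using lam by (intro divide_right_mono) auto
    then show "\<bar>ip n r ((mv n N ^^ k) r) / lam ^ Suc k\<bar> \<le> \<rho> * (\<rho> / lam) ^ Suc k"
      using lam by (simp add: power_divide abs_mult mult_ac)
  qed
  also have "\<dots> \<le> \<rho> * (2 * (\<rho> / lam))"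
    unfolding sum_distrib_left[symmetric] using rho q
    by (intro mult_left_mono geometric_quarter_le) auto
  also have "\<dots> \<le> \<rho> * 1"
  proof (rule mult_left_mono)
    show "2 * (\<rho> / lam) \<le> 1" using q(2) by linarith
  qed (rule rho(1))
  finally have T: "\<bar>T\<bar> \<le> \<rho>" by simp
  have Wii: "\<bar>W i i\<bar> \<le> \<rho>" by (rule entry_le_of_form_bounded[OF bd i])
  have D: "0 < D" using T Wii rho lam unfolding D_def by linarith
  have e: "\<bar>e\<bar> \<le> (1/4) ^ K * (lam / 4)"
  proof -
    have "\<bar>e\<bar> = \<bar>ip n u ((mv n N ^^ K) r)\<bar> / lam ^ K" using lam by (simp add: e_def)
    also have "\<dots> \<le> \<rho> ^ K * \<rho> / lam ^ K"
      using pw[of u K] nu lam by (intro divide_right_mono) auto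
    also have "\<dots> = (\<rho> / lam) ^ K * \<rho>" by (simp add: power_divide)
    also have "\<dots> \<le> (1/4) ^ K * (lam / 4)"
      using q rho lam by (intro mult_mono power_mono) auto
    finally show ?thesis .
  qed
  \<comment> \<open>testing \<open>(\<lambda> - W) u = c \<sigma>\<close> against the unit vector \<open>u\<close>\<close>
  have c: "lam / 2 \<le> \<bar>c\<bar> * sqrt n"
  proof -
    have "ip n u (\<lambda>a. lam * u a - mv n W u a) = lam - ip n u (mv n W u)"
      by (simp add: ip_diff_right ip_scale_right unit)
    moreover have "ip n u (mv n W u) \<le> \<rho>"
    proof -
      have "\<bar>ip n u (mv n W u)\<bar> \<le> \<rho> * nrm n u * nrm n u"
        using bd unfolding form_bounded_def by blast
      then show ?thesis using nu by simp
    qed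
    moreover have "ip n u (\<lambda>a. lam * u a - mv n W u a) = ip n u (\<lambda>a. c * \<sigma> a)"
      by (rule ip_cong) (auto simp: eig)
    moreover have "ip n u (\<lambda>a. c * \<sigma> a) \<le> nrm n u * nrm n (\<lambda>a. c * \<sigma> a)"
      using abs_ip_le abs_le_D1 by blast
    moreover have "nrm n (\<lambda>a. c * \<sigma> a) = \<bar>c\<bar> * sqrt n"
      using nrm_sign[of n \<sigma>] sig by (simp add: nrm_scale)
    ultimately show ?thesis using nu rho lam by simp
  qed
  have n: "0 < sqrt n" using i by simp
  have c_pos: "0 < \<bar>c\<bar>"
  proof (rule ccontr)
    assume "\<not> 0 < \<bar>c\<bar>" then show False using c lam by simp
  qed
  have s2: "\<sigma> i * \<sigma> i = 1" using sig[OF i] by auto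
  have abs_s: "\<bar>\<sigma> i\<bar> = 1" using sig[OF i] by auto
  have main: "\<bar>e\<bar> < \<bar>c\<bar> * \<eta>"
  proof -
    have "\<bar>e\<bar> \<le> (1/4) ^ K * (\<bar>c\<bar> * sqrt n)"
      using e c lam by (intro order.trans[OF e] mult_left_mono) auto
    also have "\<dots> = \<bar>c\<bar> * ((1/4) ^ K * sqrt n)" by simp
    also have "\<dots> < \<bar>c\<bar> * \<eta>" using eta c_pos by (rule mult_strict_left_mono)
    finally show ?thesis .
  qed
  have "c * \<sigma> i * (D * u i) = c * c * (\<sigma> i * \<sigma> i + \<sigma> i * S) + c * \<sigma> i * e"
    using id by (simp add: algebra_simps)
  also have "\<dots> = \<bar>c\<bar> * (\<bar>c\<bar> * (1 + \<sigma> i * S)) + c * \<sigma> i * e"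
    by (simp add: s2 abs_mult_self_eq mult.assoc[symmetric])
  also have "\<dots> \<ge> \<bar>c\<bar> * (\<bar>c\<bar> * \<eta>) - \<bar>c\<bar> * \<bar>e\<bar>"
  proof -
    have "\<bar>c\<bar> * (\<bar>c\<bar> * \<eta>) \<le> \<bar>c\<bar> * (\<bar>c\<bar> * (1 + \<sigma> i * S))"
      using row[OF i] unfolding S_def r_def N_def by (intro mult_left_mono) auto
    moreover have "\<bar>c * \<sigma> i * e\<bar> = \<bar>c\<bar> * \<bar>e\<bar>" by (simp add: abs_mult abs_s)
    ultimately show ?thesis by linarith
  qed
  moreover have "\<bar>c\<bar> * \<bar>e\<bar> < \<bar>c\<bar> * (\<bar>c\<bar> * \<eta>)"
    using main c_pos by (rule mult_strict_left_mono)
  ultimately have "0 < D * (c * \<sigma> i * u i)" by (simp add: mult_ac)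
  then show ?thesis using D by (simp add: zero_less_mult_iff)
qed

section \<open>Rayleigh quotients of symmetric matrices\<close>

text \<open>
  With all coordinates from \<open>n\<close> on fixed to zero, the sphere is a closed subset of a product of compact
  intervals, so compactness is Tychonoff's theorem.
\<close>

lemma compact_unit_sphere: "compact {x :: nat \<Rightarrow> real. (\<forall>i\<ge>n. x i = 0) \<and> ip n x x = 1}"
proof -
  let ?C = "PiE UNIV (\<lambda>i. if i < n then {-1..1} else {0::real})"
  have "compactin (product_topology (\<lambda>i. euclidean) UNIV) ?C"
    by (subst compactin_PiE) (auto simp: compactin_euclidean_iff)
  then have "compact ?C"
    unfolding euclidean_product_topology compactin_euclidean_iff .
  moreover have "closed {x :: nat \<Rightarrow> real. ip n x x = 1}"
    unfolding ip_def by (intro closed_Collect_eq continuous_intros continuous_on_product_coordinates)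
  ultimately have "compact (?C \<inter> {x. ip n x x = 1})" by (rule compact_Int_closed)
  moreover have "{x :: nat \<Rightarrow> real. (\<forall>i\<ge>n. x i = 0) \<and> ip n x x = 1} = ?C \<inter> {x. ip n x x = 1}"
  proof (intro equalityI subsetI)
    fix x :: "nat \<Rightarrow> real" assume x: "x \<in> {x. (\<forall>i\<ge>n. x i = 0) \<and> ip n x x = 1}"
    have "\<bar>x i\<bar> \<le> 1" if "i < n" for i
    proof -
      have "x i * x i \<le> ip n x x" unfolding ip_def
        using that by (intro member_le_sum[where f="\<lambda>i. x i * x i"]) auto
      then show ?thesis using x abs_square_le_1[of "x i"] by (simp add: power2_eq_square)
    qed
    then show "x \<in> ?C \<inter> {x. ip n x x = 1}" using x by (auto simp: abs_le_iff)
  next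
    fix x :: "nat \<Rightarrow> real" assume x: "x \<in> ?C \<inter> {x. ip n x x = 1}"
    then have "x i \<in> (if i < n then {-1..1} else {0})" for i by (auto simp: PiE_iff)
    then have "x i = 0" if "n \<le> i" for i using that by (metis not_le singletonD)
    then show "x \<in> {x. (\<forall>i\<ge>n. x i = 0) \<and> ip n x x = 1}" using x by auto
  qed
  ultimately show ?thesis by simp
qed

text \<open>
  A maximiser of the quadratic form on the unit sphere is an eigenvector: otherwise moving it in the
  direction of the residual \<open>h = m z - M z\<close> would increase the Rayleigh quotient to first order.
\<close>

lemma symmetric_top_eigenvector:
  assumes sym: "symmetric_below n M" and n: "0 < n"
  obtains m z where "ip n z z = 1" "\<And>i. i < n \<Longrightarrow> mv n M z i = m * z i"
    "\<And>x. ip n x (mv n M x) \<le> m * ip n x x"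
proof -
  let ?S = "{x :: nat \<Rightarrow> real. (\<forall>i\<ge>n. x i = 0) \<and> ip n x x = 1}"
  have "unit_at 0 \<in> ?S"
    using n nrm_unit_at[of 0 n] by (auto simp: ip_self unit_at_def)
  then have "?S \<noteq> {}" by blast
  moreover have "continuous_on ?S (\<lambda>x. ip n x (mv n M x))"
    unfolding ip_def mv_def
    by (intro continuous_intros continuous_on_subset[OF continuous_on_product_coordinates]) auto
  ultimately have "\<exists>z\<in>?S. \<forall>y\<in>?S. ip n y (mv n M y) \<le> ip n z (mv n M z)"
    by (rule continuous_attains_sup[OF compact_unit_sphere])
  then obtain z where z: "z \<in> ?S" and max: "\<And>y. y \<in> ?S \<Longrightarrow> ip n y (mv n M y) \<le> ip n z (mv n M z)"
    by (elim bexE) (rule that, assumption, erule bspec)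
  define m where "m = ip n z (mv n M z)"
  have zz: "ip n z z = 1" using z by simp
  have top: "ip n x (mv n M x) \<le> m * ip n x x" for x
  proof (cases "nrm n x = 0")
    case True
    then show ?thesis using abs_ip_le[of n x "mv n M x"] by (simp add: ip_self)
  next
    case False
    define y where "y i = (if i < n then (1 / nrm n x) * x i else 0)" for i
    have eq: "ip n y w = (1 / nrm n x) * ip n x w" for w
      using ip_scale_right[of n w "1 / nrm n x" x] ip_cong[of n y "\<lambda>i. (1 / nrm n x) * x i" w w]
      by (simp add: y_def ip_commute)
    have "ip n y y = (1 / nrm n x) * ((1 / nrm n x) * ip n x x)"
      by (subst eq, subst ip_commute, subst eq) simp
    then have "ip n y y = 1" using False by (simp add: ip_self power2_eq_square)
    then have "y \<in> ?S" by (auto simp: y_def)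
    then have "ip n y (mv n M y) \<le> m" using max by (simp add: m_def)
    moreover have "ip n y (mv n M y) = (1 / nrm n x) * ((1 / nrm n x) * ip n x (mv n M x))"
      using eq[of "mv n M y"] eq[of "mv n M x"] ip_mv_symmetric[OF sym, of x y] ip_commute[of n "mv n M x" y]
      by simp
    ultimately have "ip n x (mv n M x) / (nrm n x)\<^sup>2 \<le> m" by (simp add: power2_eq_square)
    then show ?thesis using False by (simp add: ip_self divide_le_eq)
  qed
  define h where "h i = m * z i - mv n M z i" for i
  have hz: "ip n h (\<lambda>i. m * z i - mv n M z i) = ip n h h" by (simp add: h_def[abs_def])
  have "ip n h h = 0"
  proof (rule ccontr)
    assume nz: "ip n h h \<noteq> 0"
    then have pos: "0 < ip n h h" by (simp add: ip_self)
    define q where "q = m * ip n h h - ip n h (mv n M h)"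
    \<comment> \<open>comparing the form at \<open>z - t h\<close> with its maximum; the linear term has to vanish\<close>
    have ineq: "0 \<le> t * t * q - 2 * t * ip n h h" for t
    proof -
      let ?x = "\<lambda>i. z i + (- t) * h i"
      have mvx: "mv n M ?x = (\<lambda>i. mv n M z i + (- t) * mv n M h i)"
        by (rule ext) (simp only: mv_add mv_scale)
      have xw: "ip n ?x w = ip n z w - t * ip n h w" for w
        using ip_add_right[of n w z "\<lambda>i. (- t) * h i"] ip_scale_right[of n w "- t" h]
        by (simp add: ip_commute)
      have wx: "ip n w (\<lambda>i. a i + (- t) * b i) = ip n w a - t * ip n w b" for w a b
        unfolding ip_add_right ip_scale_right by simp
      have form: "ip n ?x (mv n M ?x) = m - 2 * t * ip n h (mv n M z) + t * t * ip n h (mv n M h)"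
        unfolding mvx xw wx using ip_mv_symmetric[OF sym, of z h] ip_commute[of n h "mv n M z"]
        by (simp add: m_def algebra_simps)
      have self: "ip n ?x ?x = 1 - 2 * t * ip n h z + t * t * ip n h h"
        unfolding xw wx using zz ip_commute[of n h z] by (simp add: algebra_simps)
      have cross: "ip n h (mv n M z) = m * ip n h z - ip n h h"
        using hz by (simp add: ip_diff_right ip_scale_right)
      show ?thesis
        using top[of ?x] unfolding form self cross q_def by (simp add: algebra_simps)
    qed
    have "0 \<le> q" using ineq[of 1] ineq[of "-1"] by simp
    show False
    proof (cases "q = 0")
      case True then show False using ineq[of 1] pos by simp
    next
      case False
      then have q: "0 < q" using \<open>0 \<le> q\<close> by simp
      have "0 \<le> ip n h h / q * (ip n h h) - 2 * (ip n h h / q) * ip n h h"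
        using ineq[of "ip n h h / q"] q by simp
      then have "ip n h h / q * ip n h h \<le> 0" by simp
      then show False using q pos by (simp add: mult_le_0_iff divide_le_0_iff)
    qed
  qed
  then have "h i = 0" if "i < n" for i
    using that by (simp add: ip_def sum_nonneg_eq_0_iff)
  then have "mv n M z i = m * z i" if "i < n" for i using that by (simp add: h_def)
  then show thesis using that zz top by blast
qed

section \<open>Operator norms via a lattice net\<close>

text \<open>
  Integer vectors which, divided by \<open>4 * sqrt n\<close>, give a \<open>1/4\<close>-net of the unit ball: rounding
  moves each of the \<open>n\<close> entries by at most \<open>1 / (4 * sqrt n)\<close>, hence the vector by at most
  \<open>1/4\<close>, and \<open>16 * n\<close> is the square of the scaling factor.
\<close>

definition grid :: "nat \<Rightarrow> (nat \<Rightarrow> int) set" where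
  "grid n = {z \<in> extensional {..<n}. (\<Sum>i<n. (z i)\<^sup>2) \<le> 16 * int n}"

definition grid_point :: "nat \<Rightarrow> (nat \<Rightarrow> int) \<Rightarrow> nat \<Rightarrow> real" where
  "grid_point n z i = real_of_int (z i) / (4 * sqrt n)"

lemma nrm_grid_point_le:
  assumes "0 < n" "z \<in> grid n"
  shows "nrm n (grid_point n z) \<le> 1"
proof -
  have "(\<Sum>i<n. (grid_point n z i)\<^sup>2) = real_of_int (\<Sum>i<n. (z i)\<^sup>2) / (16 * real n)"
    by (simp add: grid_point_def power_divide power_mult_distrib sum_divide_distrib)
  also have "\<dots> \<le> real_of_int (16 * int n) / (16 * real n)"
    using assms(2) unfolding grid_def by (intro divide_right_mono) (auto simp del: of_int_sum of_int_power of_int_mult)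
  also have "\<dots> = 1" using assms(1) by simp
  finally show ?thesis by (simp add: nrm_def L2_set_def)
qed

text \<open>
  Rounding towards zero can only shorten a vector, so the rounded vector stays in the grid.
\<close>

lemma grid_approx:
  assumes n: "0 < n" and x: "nrm n x \<le> 1"
  obtains z where "z \<in> grid n" "nrm n (\<lambda>i. x i - grid_point n z i) \<le> 1/4"
proof -
  define s where "s = 4 * sqrt n"
  have s: "0 < s" using n by (simp add: s_def)
  define z where "z i = (if i < n then (if 0 \<le> x i then \<lfloor>s * x i\<rfloor> else \<lceil>s * x i\<rceil>) else undefined)" for i
  have zi: "\<bar>real_of_int (z i)\<bar> \<le> \<bar>s * x i\<bar>" "\<bar>s * x i - z i\<bar> \<le> 1" if "i < n" for i
  proof -
    show "\<bar>real_of_int (z i)\<bar> \<le> \<bar>s * x i\<bar>"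
    proof (cases "0 \<le> x i")
      case True
      then have "0 \<le> s * x i" using s by simp
      then show ?thesis using True that by (simp add: z_def)
    next
      case False
      then have "s * x i \<le> 0" using s by (simp add: mult_le_0_iff)
      then show ?thesis using False that ceiling_le_zero[of "s * x i"] le_of_int_ceiling[of "s * x i"]
        by (simp add: z_def abs_if del: ceiling_le_zero) 
    qed
    show "\<bar>s * x i - z i\<bar> \<le> 1" using that by (simp add: z_def) linarith
  qed
  have "real_of_int (\<Sum>i<n. (z i)\<^sup>2) = (\<Sum>i<n. (real_of_int (z i))\<^sup>2)" by simp
  also have "\<dots> \<le> (\<Sum>i<n. (s * x i)\<^sup>2)"
    using zi(1) by (intro sum_mono) (simp add: abs_le_square_iff)
  also have "\<dots> = s\<^sup>2 * (nrm n x)\<^sup>2"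
    by (simp add: nrm_def L2_set_def sum_nonneg power_mult_distrib sum_distrib_left)
  also have "\<dots> \<le> s\<^sup>2 * 1" using x by (intro mult_left_mono) (auto simp: power_le_one)
  also have "\<dots> = real_of_int (16 * int n)" by (simp add: s_def power_mult_distrib)
  finally have "(\<Sum>i<n. (z i)\<^sup>2) \<le> 16 * int n" by (simp only: of_int_le_iff)
  then have "z \<in> grid n" by (auto simp: grid_def extensional_def z_def)
  moreover have "nrm n (\<lambda>i. x i - grid_point n z i) \<le> nrm n (\<lambda>i. (1 / s) * 1)"
  proof (rule nrm_le_of_abs_le)
    fix i assume "i < n"
    have "x i - grid_point n z i = (s * x i - z i) / s"
      using s unfolding grid_point_def s_def[symmetric] by (simp add: field_simps)
    then show "\<bar>x i - grid_point n z i\<bar> \<le> \<bar>1 / s * 1\<bar>"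
      using zi(2)[OF \<open>i < n\<close>] s by (simp add: divide_right_mono)
  qed
  moreover have "nrm n (\<lambda>i. (1 / s) * 1) = 1/4"
    unfolding nrm_scale using nrm_sign[of n "\<lambda>_. 1"] n by (simp add: s_def)
  ultimately show thesis using that by simp
qed

text \<open>
  Let \<open>S\<close> be the operator norm, a finite supremum. Replacing both arguments of the form by grid
  points at distance at most \<open>1/4\<close> costs \<open>S / 4\<close> each, so \<open>S \<le> t + S / 2\<close>.
\<close>

lemma form_bounded_of_grid:
  assumes n: "0 < n"
    and t: "\<And>z z'. z \<in> grid n \<Longrightarrow> z' \<in> grid n \<Longrightarrow> \<bar>ip n (grid_point n z) (mv n M (grid_point n z'))\<bar> \<le> t"
  shows "form_bounded n M (2 * t)"
proof -
  let ?U = "{x. nrm n x \<le> 1}"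
  let ?f = "\<lambda>(x, y). \<bar>ip n x (mv n M y)\<bar>"
  have entry: "\<bar>x i\<bar> \<le> 1" if "x \<in> ?U" "i < n" for x i
  proof -
    have "\<bar>x i\<bar> = \<bar>ip n x (unit_at i)\<bar>" using that by (simp add: ip_unit_at)
    also have "\<dots> \<le> nrm n x * nrm n (unit_at i)" by (rule abs_ip_le)
    also have "\<dots> \<le> 1" using that by (simp add: nrm_unit_at)
    finally show ?thesis .
  qed
  have bdd: "bdd_above (?f ` (?U \<times> ?U))"
  proof (rule bdd_aboveI2)
    fix p assume p: "p \<in> ?U \<times> ?U"
    obtain x y where xy: "p = (x, y)" by (cases p)
    have "\<bar>ip n x (mv n M y)\<bar> \<le> (\<Sum>i<n. \<bar>x i * mv n M y i\<bar>)" unfolding ip_def by (rule sum_abs)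
    also have "\<dots> \<le> (\<Sum>i<n. \<Sum>j<n. \<bar>M i j\<bar>)"
    proof (rule sum_mono)
      fix i assume i: "i \<in> {..<n}"
      have "\<bar>mv n M y i\<bar> \<le> (\<Sum>j<n. \<bar>M i j * y j\<bar>)" unfolding mv_def by (rule sum_abs)
      also have "\<dots> \<le> (\<Sum>j<n. \<bar>M i j\<bar>)"
        using entry[of y] p xy by (intro sum_mono) (auto simp: abs_mult mult_left_le)
      finally have "\<bar>mv n M y i\<bar> \<le> (\<Sum>j<n. \<bar>M i j\<bar>)" .
      moreover have "\<bar>x i * mv n M y i\<bar> \<le> 1 * \<bar>mv n M y i\<bar>"
        unfolding abs_mult using entry[of x i] p xy i by (intro mult_right_mono) auto
      ultimately show "\<bar>x i * mv n M y i\<bar> \<le> (\<Sum>j<n. \<bar>M i j\<bar>)" by simp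
    qed
    finally show "?f p \<le> (\<Sum>i<n. \<Sum>j<n. \<bar>M i j\<bar>)" by (simp add: xy)
  qed
  define S where "S = (SUP p\<in>?U \<times> ?U. ?f p)"
  have le_S: "\<bar>ip n x (mv n M y)\<bar> \<le> S" if "x \<in> ?U" "y \<in> ?U" for x y
    unfolding S_def using cSUP_upper[OF _ bdd, of "(x, y)"] that by simp
  have zero: "(\<lambda>_. 0) \<in> ?U" by (simp add: nrm_def L2_set_def)
  have S0: "0 \<le> S" using le_S[OF zero zero] abs_ge_zero by (rule order.trans[rotated])
  have scaled: "\<bar>ip n x (mv n M y)\<bar> \<le> S * nrm n x * nrm n y" for x y
  proof (cases "nrm n x = 0 \<or> nrm n y = 0")
    case True
    have "ip n x (mv n M y) = 0"
    proof (cases "nrm n x = 0")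
      case True then show ?thesis using abs_ip_le[of n x "mv n M y"] by simp
    next
      case False
      then have "nrm n y = 0" using True by simp
      then have "ip n y y = 0" by (simp add: ip_self)
      then have "\<And>j. j < n \<Longrightarrow> y j = 0" by (simp add: ip_def sum_nonneg_eq_0_iff)
      then show ?thesis by (simp add: ip_def mv_def)
    qed
    then show ?thesis using True by auto
  next
    case False
    let ?x = "\<lambda>i. (1 / nrm n x) * x i" and ?y = "\<lambda>i. (1 / nrm n y) * y i"
    have "mv n M ?y = (\<lambda>i. (1 / nrm n y) * mv n M y i)" by (rule ext) (rule mv_scale)
    then have "ip n ?x (mv n M ?y) = (1 / nrm n y) * ((1 / nrm n x) * ip n x (mv n M y))"
      using ip_scale_right[of n ?x "1 / nrm n y" "mv n M y"] ip_scale_right[of n "mv n M y" "1 / nrm n x" x]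
      by (simp add: ip_commute[of n "mv n M y"])
    moreover have "\<bar>ip n ?x (mv n M ?y)\<bar> \<le> S"
      by (rule le_S) (simp_all only: nrm_scale mem_Collect_eq, auto)
    moreover have "nrm n x * (nrm n y * \<bar>ip n ?x (mv n M ?y)\<bar>) \<le> nrm n x * (nrm n y * S)"
      using calculation(2) by (intro mult_left_mono) auto
    ultimately show ?thesis using False by (simp add: abs_mult mult_ac)
  qed
  have "S \<le> t + S / 2"
    unfolding S_def
  proof (rule cSUP_least)
    show "?U \<times> ?U \<noteq> {}" using zero by blast
  next
    fix p assume "p \<in> ?U \<times> ?U"
    then obtain x y where p: "p = (x, y)" and x: "nrm n x \<le> 1" and y: "nrm n y \<le> 1" by auto
    obtain a where a: "a \<in> grid n" and xa: "nrm n (\<lambda>i. x i - grid_point n a i) \<le> 1/4"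
      by (rule grid_approx[OF n x])
    obtain b where b: "b \<in> grid n" and yb: "nrm n (\<lambda>i. y i - grid_point n b i) \<le> 1/4"
      by (rule grid_approx[OF n y])
    let ?a = "grid_point n a" and ?b = "grid_point n b"
    let ?dx = "\<lambda>i. x i - ?a i" and ?dy = "\<lambda>i. y i - ?b i"
    have mvd: "mv n M ?dy = (\<lambda>i. mv n M y i - mv n M ?b i)" by (rule ext) (rule mv_diff)
    have "ip n x (mv n M y) = ip n ?dx (mv n M y) + ip n ?a (mv n M ?dy) + ip n ?a (mv n M ?b)"
      unfolding mvd ip_diff_right by (subst (2) ip_commute) (simp add: ip_diff_right ip_commute)
    moreover have "\<bar>ip n ?dx (mv n M y)\<bar> \<le> S / 4"
    proof -
      have "\<bar>ip n ?dx (mv n M y)\<bar> \<le> S * nrm n ?dx * nrm n y" by (rule scaled)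
      also have "\<dots> \<le> S * (1/4) * 1" using S0 xa y by (intro mult_mono mult_left_mono) auto
      finally show ?thesis by simp
    qed
    moreover have "\<bar>ip n ?a (mv n M ?dy)\<bar> \<le> S / 4"
    proof -
      have "\<bar>ip n ?a (mv n M ?dy)\<bar> \<le> S * nrm n ?a * nrm n ?dy" by (rule scaled)
      also have "\<dots> \<le> S * 1 * (1/4)"
        using S0 yb nrm_grid_point_le[OF n a] by (intro mult_mono mult_left_mono) auto
      finally show ?thesis by simp
    qed
    moreover have "\<bar>ip n ?a (mv n M ?b)\<bar> \<le> t" by (rule t[OF a b])
    ultimately show "?f p \<le> t + (SUP p\<in>?U \<times> ?U. ?f p) / 2"
      unfolding p S_def[symmetric] by simp
  qed
  then have "S \<le> 2 * t" by simp
  show ?thesis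
    unfolding form_bounded_def
  proof (intro allI)
    fix x y
    have "\<bar>ip n x (mv n M y)\<bar> \<le> S * (nrm n x * nrm n y)" using scaled by (simp add: mult.assoc)
    also have "\<dots> \<le> 2 * t * (nrm n x * nrm n y)" using \<open>S \<le> 2 * t\<close> by (intro mult_right_mono) auto
    finally show "\<bar>ip n x (mv n M y)\<bar> \<le> 2 * t * nrm n x * nrm n y" by (simp add: mult.assoc)
  qed
qed

lemma sum_half_power_abs_le: "(\<Sum>k\<in>{- int m..int m}. (1/2::real) ^ nat \<bar>k\<bar>) \<le> 4"
proof -
  have "(\<Sum>k\<in>{- int m..int m}. (1/2::real) ^ nat \<bar>k\<bar>) = 3 - 2 * (1/2) ^ m"
  proof (induction m)
    case (Suc m)
    have "{- int (Suc m)..int (Suc m)} = insert (int (Suc m)) (insert (- int (Suc m)) {- int m..int m})"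
      by auto
    then show ?case using Suc by (simp add: nat_add_distrib)
  qed simp
  then show ?thesis by (simp add: order.trans[of _ 3])
qed

text \<open>
  Give an integer vector the weight \<open>2\<close> to the power minus its \<open>\<ell>\<^sup>1\<close> norm. The weight factorises
  over the coordinates, so the total weight is at most \<open>4 ^ n\<close>. On integers the
  \<open>\<ell>\<^sup>1\<close> norm is at most the squared Euclidean norm, so every grid vector weighs at least
  \<open>2\<close> to the power \<open>- 16 n\<close>.
\<close>

lemma card_grid: "finite (grid n)" "real (card (grid n)) \<le> 2 ^ (18 * n)"
proof -
  let ?B = "PiE {..<n} (\<lambda>_. {- int (16 * n)..int (16 * n)})"
  have abs_le: "\<bar>a\<bar> \<le> a\<^sup>2" for a :: int
    using mult_right_mono[of 1 "\<bar>a\<bar>" "\<bar>a\<bar>"]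
    by (cases "a = 0") (simp_all add: power2_eq_square flip: abs_mult)
  have sum_abs: "(\<Sum>i<n. \<bar>z i\<bar>) \<le> 16 * int n" if "z \<in> grid n" for z
  proof -
    have "(\<Sum>i<n. \<bar>z i\<bar>) \<le> (\<Sum>i<n. (z i)\<^sup>2)" by (intro sum_mono abs_le)
    then show ?thesis using that by (simp add: grid_def)
  qed
  have sub: "grid n \<subseteq> ?B"
  proof
    fix z assume z: "z \<in> grid n"
    have "\<bar>z i\<bar> \<le> 16 * int n" if "i < n" for i
      using member_le_sum[of i "{..<n}" "\<lambda>i. \<bar>z i\<bar>"] sum_abs[OF z] that by simp
    then have "z i \<in> {- int (16 * n)..int (16 * n)}" if "i < n" for i
      using that by (simp add: abs_le_iff minus_le_iff)
    then show "z \<in> ?B" using z by (simp add: PiE_iff grid_def del: atLeastAtMost_iff)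
  qed
  have fin: "finite ?B" by (intro finite_PiE) auto
  show "finite (grid n)" using sub fin by (rule finite_subset)
  let ?w = "\<lambda>z. \<Prod>i<n. (1/2::real) ^ nat \<bar>z i\<bar>"
  have "real (card (grid n)) * (1/2) ^ (16 * n) = (\<Sum>z\<in>grid n. (1/2) ^ (16 * n))" by simp
  also have "\<dots> \<le> (\<Sum>z\<in>grid n. ?w z)"
  proof (rule sum_mono)
    fix z assume z: "z \<in> grid n"
    have "?w z = (1/2) ^ (\<Sum>i<n. nat \<bar>z i\<bar>)" by (simp add: power_sum)
    moreover have "(\<Sum>i<n. nat \<bar>z i\<bar>) \<le> 16 * n"
      using sum_abs[OF z] by (simp flip: of_nat_le_iff[where ?'a=int])
    ultimately show "(1/2) ^ (16 * n) \<le> ?w z" by (simp add: power_decreasing)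
  qed
  also have "\<dots> \<le> (\<Sum>z\<in>?B. ?w z)"
    using sub fin by (intro sum_mono2) (auto intro!: prod_nonneg)
  also have "\<dots> = (\<Prod>i<n. \<Sum>k\<in>{- int (16 * n)..int (16 * n)}. (1/2::real) ^ nat \<bar>k\<bar>)"
    by (rule prod_sum_PiE[symmetric]) auto
  also have "\<dots> \<le> (\<Prod>i<n. 4)"
    by (intro prod_mono conjI sum_nonneg sum_half_power_abs_le) auto
  finally have "real (card (grid n)) * (1/2) ^ (16 * n) \<le> 4 ^ n" by simp
  then have "real (card (grid n)) \<le> 4 ^ n * 2 ^ (16 * n)" by (simp add: field_simps power_one_over)
  also have "\<dots> = 2 ^ (18 * n)"
    by (simp add: power_mult power_mult_distrib[symmetric])
  finally show "real (card (grid n)) \<le> 2 ^ (18 * n)" .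
qed

section \<open>Gaussian tails with independent random coefficients\<close>

text \<open>
  Completing the square turns the tilted density into a normal density centred at \<open>c * \<tau>\<^sup>2\<close>.
\<close>

lemma (in prob_space) normal_exp_moment:
  assumes X: "distributed M lborel X (\<lambda>x. ennreal (normal_density 0 \<tau> x))" and tau: "0 < \<tau>"
  shows "(\<integral>\<^sup>+\<omega>. ennreal (exp (c * X \<omega>)) \<partial>M) = ennreal (exp (c\<^sup>2 * \<tau>\<^sup>2 / 2))"
proof -
  have shift: "normal_density 0 \<tau> x * exp (c * x) = exp (c\<^sup>2 * \<tau>\<^sup>2 / 2) * normal_density (c * \<tau>\<^sup>2) \<tau> x" for x
  proof -
    have "- (x - 0)\<^sup>2 / (2 * \<tau>\<^sup>2) + c * x = c\<^sup>2 * \<tau>\<^sup>2 / 2 + - (x - c * \<tau>\<^sup>2)\<^sup>2 / (2 * \<tau>\<^sup>2)"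
      using tau by (simp add: field_simps power2_eq_square)
    then have "exp (- (x - 0)\<^sup>2 / (2 * \<tau>\<^sup>2)) * exp (c * x)
        = exp (c\<^sup>2 * \<tau>\<^sup>2 / 2) * exp (- (x - c * \<tau>\<^sup>2)\<^sup>2 / (2 * \<tau>\<^sup>2))"
      unfolding exp_add[symmetric] by (rule arg_cong)
    then show ?thesis unfolding normal_density_def by (simp add: mult_ac)
  qed
  have "(\<integral>\<^sup>+\<omega>. ennreal (exp (c * X \<omega>)) \<partial>M)
      = (\<integral>\<^sup>+x. ennreal (normal_density 0 \<tau> x) * ennreal (exp (c * x)) \<partial>lborel)"
    by (rule distributed_nn_integral[OF X, symmetric]) simp
  also have "\<dots> = (\<integral>\<^sup>+x. ennreal (exp (c\<^sup>2 * \<tau>\<^sup>2 / 2)) * ennreal (normal_density (c * \<tau>\<^sup>2) \<tau> x) \<partial>lborel)"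
    by (intro nn_integral_cong) (simp add: ennreal_mult[symmetric] shift normal_density_nonneg)
  also have "\<dots> = ennreal (exp (c\<^sup>2 * \<tau>\<^sup>2 / 2)) * (\<integral>\<^sup>+x. ennreal (normal_density (c * \<tau>\<^sup>2) \<tau> x) \<partial>lborel)"
    by (rule nn_integral_cmult) simp
  also have "(\<integral>\<^sup>+x. ennreal (normal_density (c * \<tau>\<^sup>2) \<tau> x) \<partial>lborel) = 1"
    using tau by (subst nn_integral_eq_integral) (auto simp: normal_density_nonneg)
  finally show ?thesis by simp
qed

text \<open>
  Chernoff's bound with the exponent \<open>\<theta> = t / (\<tau>\<^sup>2 * s)\<close>, which is optimal for variance \<open>\<tau>\<^sup>2 * s\<close>.
\<close>

lemma (in prob_space) gaussian_sum_tail: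
  assumes J: "finite J" and ind: "indep_vars (\<lambda>_. borel) X J"
    and X: "\<And>j. j \<in> J \<Longrightarrow> distributed M lborel (X j) (\<lambda>x. ennreal (normal_density 0 \<tau> x))"
    and tau: "0 < \<tau>" and s: "(\<Sum>j\<in>J. (a j)\<^sup>2) \<le> s" "0 < s" and t: "0 \<le> t"
  shows "prob {\<omega> \<in> space M. t \<le> (\<Sum>j\<in>J. a j * X j \<omega>)} \<le> exp (- t\<^sup>2 / (2 * \<tau>\<^sup>2 * s))"
proof (cases "t = 0")
  case True then show ?thesis by (simp add: prob_le_1)
next
  case False
  define \<theta> where "\<theta> = t / (\<tau>\<^sup>2 * s)"
  have th: "0 < \<theta>" using False t tau s by (simp add: \<theta>_def)
  have meas: "X j \<in> borel_measurable M" if "j \<in> J" for j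
    using ind that by (simp add: indep_vars_def)
  have meas_sum: "(\<lambda>\<omega>. \<Sum>j\<in>J. a j * X j \<omega>) \<in> borel_measurable M"
    by (intro borel_measurable_sum borel_measurable_times borel_measurable_const meas)
  have indE: "indep_vars (\<lambda>_. borel) (\<lambda>j \<omega>. ennreal (exp (\<theta> * a j * X j \<omega>))) J"
    by (rule indep_vars_compose2[OF ind]) simp
  have "(\<integral>\<^sup>+\<omega>. ennreal (exp (\<theta> * (\<Sum>j\<in>J. a j * X j \<omega>))) \<partial>M)
      = (\<integral>\<^sup>+\<omega>. (\<Prod>j\<in>J. ennreal (exp (\<theta> * a j * X j \<omega>))) \<partial>M)"
    by (intro nn_integral_cong) (simp add: prod_ennreal exp_sum[OF J, symmetric] sum_distrib_left mult.assoc)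
  also have "\<dots> = (\<Prod>j\<in>J. \<integral>\<^sup>+\<omega>. ennreal (exp (\<theta> * a j * X j \<omega>)) \<partial>M)"
    by (rule indep_vars_nn_integral[OF J indE]) simp
  also have "\<dots> = (\<Prod>j\<in>J. ennreal (exp ((\<theta> * a j)\<^sup>2 * \<tau>\<^sup>2 / 2)))"
    by (intro prod.cong refl normal_exp_moment X tau)
  also have "\<dots> = ennreal (exp (\<Sum>j\<in>J. (\<theta> * a j)\<^sup>2 * \<tau>\<^sup>2 / 2))"
    by (simp add: prod_ennreal exp_sum[OF J])
  also have "(\<Sum>j\<in>J. (\<theta> * a j)\<^sup>2 * \<tau>\<^sup>2 / 2) = \<theta>\<^sup>2 * \<tau>\<^sup>2 / 2 * (\<Sum>j\<in>J. (a j)\<^sup>2)"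
    by (simp add: sum_distrib_left power_mult_distrib mult_ac)
  finally have mgf: "(\<integral>\<^sup>+\<omega>. ennreal (exp (\<theta> * (\<Sum>j\<in>J. a j * X j \<omega>))) \<partial>M)
      = ennreal (exp (\<theta>\<^sup>2 * \<tau>\<^sup>2 / 2 * (\<Sum>j\<in>J. (a j)\<^sup>2)))" .
  have "emeasure M {\<omega> \<in> space M. t \<le> (\<Sum>j\<in>J. a j * X j \<omega>)}
      \<le> ennreal (exp (- \<theta> * t)) * (\<integral>\<^sup>+\<omega>. ennreal (exp (\<theta> * (\<Sum>j\<in>J. a j * X j \<omega>))) * indicator (space M) \<omega> \<partial>M)"
    by (rule Chernoff_ineq_nn_integral_ge[OF th sets.top])
       (intro borel_measurable_times meas_sum borel_measurable_indicator sets.top)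
  also have "(\<integral>\<^sup>+\<omega>. ennreal (exp (\<theta> * (\<Sum>j\<in>J. a j * X j \<omega>))) * indicator (space M) \<omega> \<partial>M)
      = (\<integral>\<^sup>+\<omega>. ennreal (exp (\<theta> * (\<Sum>j\<in>J. a j * X j \<omega>))) \<partial>M)"
    by (intro nn_integral_cong) simp
  also have "ennreal (exp (- \<theta> * t)) * \<dots>
      = ennreal (exp (\<theta>\<^sup>2 * \<tau>\<^sup>2 / 2 * (\<Sum>j\<in>J. (a j)\<^sup>2) - \<theta> * t))"
    unfolding mgf by (simp add: ennreal_mult[symmetric] exp_add[symmetric])
  also have "\<dots> \<le> ennreal (exp (\<theta>\<^sup>2 * \<tau>\<^sup>2 / 2 * s - \<theta> * t))"
    using s by (intro ennreal_leI) (simp add: mult_left_mono)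
  also have "\<theta>\<^sup>2 * \<tau>\<^sup>2 / 2 * s - \<theta> * t = - t\<^sup>2 / (2 * \<tau>\<^sup>2 * s)"
    using tau s by (simp add: \<theta>_def field_simps power2_eq_square)
  finally show ?thesis by (simp add: emeasure_eq_measure)
qed

text \<open>
  The coefficients may depend on the variables outside \<open>J\<close>. Conditionally on those, the sum has
  fixed coefficients, and the fixed-coefficient tail bound applies whenever their squares sum to at
  most \<open>s\<close>; integrating over the other variables keeps the bound. The self-normalised form of the
  event is what allows \<open>s\<close> to be justified later from the same sample.
\<close>

lemma (in prob_space) gaussian_sum_tail_random_coefficients:
  fixes X :: "'i \<Rightarrow> 'a \<Rightarrow> real" and a :: "('i \<Rightarrow> real) \<Rightarrow> 'i \<Rightarrow> real"
  assumes I: "finite I" and ind: "indep_vars (\<lambda>_. borel) X I"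
    and X: "\<And>j. j \<in> I \<Longrightarrow> distributed M lborel (X j) (\<lambda>x. ennreal (normal_density 0 \<tau> x))"
    and tau: "0 < \<tau>" and J: "J \<subseteq> I"
    and a: "\<And>j. j \<in> J \<Longrightarrow> (\<lambda>z. a z j) \<in> borel_measurable (PiM (I - J) (\<lambda>_. borel))"
    and s: "0 < s" and t: "0 \<le> t"
  shows "prob {\<omega> \<in> space M. t \<le> (\<Sum>j\<in>J. a (\<lambda>i\<in>I - J. X i \<omega>) j * X j \<omega>)
            \<and> (\<Sum>j\<in>J. (a (\<lambda>i\<in>I - J. X i \<omega>) j)\<^sup>2) \<le> s}
         \<le> exp (- t\<^sup>2 / (2 * \<tau>\<^sup>2 * s))" (is "prob ?E \<le> ?b")
    and "{\<omega> \<in> space M. t \<le> (\<Sum>j\<in>J. a (\<lambda>i\<in>I - J. X i \<omega>) j * X j \<omega>)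
            \<and> (\<Sum>j\<in>J. (a (\<lambda>i\<in>I - J. X i \<omega>) j)\<^sup>2) \<le> s} \<in> events"
proof -
  let ?PJ = "PiM J (\<lambda>_. borel :: real measure)" and ?PK = "PiM (I - J) (\<lambda>_. borel :: real measure)"
  define Y where "Y \<omega> = (\<lambda>i\<in>J. X i \<omega>)" for \<omega>
  define Z where "Z \<omega> = (\<lambda>i\<in>I - J. X i \<omega>)" for \<omega>
  have finJ: "finite J" using I J by (rule rev_finite_subset)
  have iv: "indep_var ?PJ Y ?PK Z"
    unfolding Y_def Z_def by (rule indep_var_restrict[OF ind]) (use J in auto)
  have Y: "Y \<in> measurable M ?PJ" and Z: "Z \<in> measurable M ?PK"
    and joint: "distr M ?PJ Y \<Otimes>\<^sub>M distr M ?PK Z = distr M (?PJ \<Otimes>\<^sub>M ?PK) (\<lambda>\<omega>. (Y \<omega>, Z \<omega>))"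
    using iv unfolding indep_var_distribution_eq by auto
  define S where "S = {p \<in> space (?PJ \<Otimes>\<^sub>M ?PK).
      t \<le> (\<Sum>j\<in>J. a (snd p) j * fst p j) \<and> (\<Sum>j\<in>J. (a (snd p) j)\<^sup>2) \<le> s}"
  have m1: "(\<lambda>p. a (snd p) j) \<in> borel_measurable (?PJ \<Otimes>\<^sub>M ?PK)" if "j \<in> J" for j
    by (rule measurable_compose[OF measurable_snd a[OF that]])
  have m2: "(\<lambda>p. fst p j) \<in> borel_measurable (?PJ \<Otimes>\<^sub>M ?PK)" if "j \<in> J" for j
    by (rule measurable_compose[OF measurable_fst measurable_component_singleton[OF that]])
  have S: "S \<in> sets (?PJ \<Otimes>\<^sub>M ?PK)"
    unfolding S_def
    by (intro sets.sets_Collect_conj borel_measurable_le borel_measurable_const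
        borel_measurable_sum borel_measurable_times borel_measurable_power m1 m2)
  have E: "?E = (\<lambda>\<omega>. (Y \<omega>, Z \<omega>)) -` S \<inter> space M"
    using measurable_space[OF Y] measurable_space[OF Z]
    unfolding S_def by (auto simp: space_pair_measure Y_def[symmetric] Z_def[symmetric])
       (auto simp: Y_def cong: sum.cong)
  have YZ: "(\<lambda>\<omega>. (Y \<omega>, Z \<omega>)) \<in> measurable M (?PJ \<Otimes>\<^sub>M ?PK)" using Y Z by simp
  show "?E \<in> events" unfolding E by (rule measurable_sets[OF YZ S])
  interpret PY: prob_space "distr M ?PJ Y" by (rule prob_space_distr[OF Y])
  interpret PZ: prob_space "distr M ?PK Z" by (rule prob_space_distr[OF Z])
  interpret PP: pair_sigma_finite "distr M ?PJ Y" "distr M ?PK Z" ..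
  have "emeasure M ?E = emeasure (distr M (?PJ \<Otimes>\<^sub>M ?PK) (\<lambda>\<omega>. (Y \<omega>, Z \<omega>))) S"
    unfolding E by (rule emeasure_distr[OF YZ S, symmetric])
  also have "\<dots> = emeasure (distr M ?PJ Y \<Otimes>\<^sub>M distr M ?PK Z) S" unfolding joint ..
  also have "\<dots> = (\<integral>\<^sup>+z. emeasure (distr M ?PJ Y) ((\<lambda>y. (y, z)) -` S) \<partial>distr M ?PK Z)"
    by (rule PP.emeasure_pair_measure_alt2) (use S in \<open>simp cong: sets_pair_measure_cong\<close>)
  also have "\<dots> \<le> (\<integral>\<^sup>+z. ennreal ?b \<partial>distr M ?PK Z)"
  proof (rule nn_integral_mono)
    fix z assume "z \<in> space (distr M ?PK Z)"
    show "emeasure (distr M ?PJ Y) ((\<lambda>y. (y, z)) -` S) \<le> ennreal ?b"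
    proof (cases "(\<Sum>j\<in>J. (a z j)\<^sup>2) \<le> s")
      case True
      have "(\<lambda>y. (y, z)) -` S \<in> sets ?PJ" using S by (rule sets_Pair2)
      then have "emeasure (distr M ?PJ Y) ((\<lambda>y. (y, z)) -` S) = emeasure M (Y -` ((\<lambda>y. (y, z)) -` S) \<inter> space M)"
        by (rule emeasure_distr[OF Y])
      also have "\<dots> \<le> emeasure M {\<omega> \<in> space M. t \<le> (\<Sum>j\<in>J. a z j * X j \<omega>)}"
      proof (rule emeasure_mono)
        have "(\<Sum>j\<in>J. a z j * Y \<omega> j) = (\<Sum>j\<in>J. a z j * X j \<omega>)" for \<omega>
          by (intro sum.cong) (auto simp: Y_def)
        then show "Y -` ((\<lambda>y. (y, z)) -` S) \<inter> space M \<subseteq> {\<omega> \<in> space M. t \<le> (\<Sum>j\<in>J. a z j * X j \<omega>)}"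
          by (auto simp: S_def)
        have "X j \<in> borel_measurable M" if "j \<in> J" for j
          using ind J that by (auto simp: indep_vars_def)
        then show "{\<omega> \<in> space M. t \<le> (\<Sum>j\<in>J. a z j * X j \<omega>)} \<in> events"
          by (intro borel_measurable_le borel_measurable_const borel_measurable_sum borel_measurable_times)
      qed
      also have "\<dots> \<le> ennreal ?b"
        unfolding emeasure_eq_measure
        by (intro ennreal_leI gaussian_sum_tail[OF finJ indep_vars_subset[OF ind J] X tau True s t])
           (use J in auto)
      finally show ?thesis .
    next
      case False
      then have "(\<lambda>y. (y, z)) -` S = {}" by (auto simp: S_def)
      then show ?thesis by simp
    qed
  qed
  also have "\<dots> = ennreal ?b" by (simp only: nn_integral_const PZ.emeasure_space_1 mult_1_right)
  finally show "prob ?E \<le> ?b" by (simp add: emeasure_eq_measure)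
qed

section \<open>Symmetric Gaussian noise\<close>

text \<open>
  The independent entries of a symmetric matrix are indexed by the pairs on and above the diagonal.
\<close>

definition upper_pairs :: "nat \<Rightarrow> (nat \<times> nat) set" where
  "upper_pairs n = {(i, j). i \<le> j \<and> j < n}"

definition row_pairs :: "nat \<Rightarrow> nat \<Rightarrow> (nat \<times> nat) set" where
  "row_pairs n i = (\<lambda>j. (min i j, max i j)) ` ({..<n} - {i})"

definition opposite_end :: "nat \<Rightarrow> nat \<times> nat \<Rightarrow> nat" where
  "opposite_end i p = (if fst p = i then snd p else fst p)"

definition sym_ext :: "(nat \<times> nat \<Rightarrow> real) \<Rightarrow> nat \<Rightarrow> nat \<Rightarrow> real" where
  "sym_ext x a b = x (min a b, max a b)"

lemma finite_upper_pairs [simp]: "finite (upper_pairs n)"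
proof -
  have "upper_pairs n \<subseteq> {..<n} \<times> {..<n}" by (auto simp: upper_pairs_def)
  then show ?thesis by (rule finite_subset) simp
qed

lemma symmetric_below_sym_ext: "symmetric_below n (sym_ext x)"
  by (simp add: symmetric_below_def sym_ext_def min.commute max.commute)

lemma row_pairs_subset: "i < n \<Longrightarrow> row_pairs n i \<subseteq> upper_pairs n"
  by (auto simp: row_pairs_def upper_pairs_def)

lemma sum_row_pairs:
  "(\<Sum>p\<in>row_pairs n i. f (opposite_end i p) p) = (\<Sum>j\<in>{..<n} - {i}. f j (min i j, max i j))"
proof -
  have inj: "inj_on (\<lambda>j. (min i j, max i j)) ({..<n} - {i})"
    by (auto simp: inj_on_def min_def max_def split: if_splits)
  have "opposite_end i (min i j, max i j) = j" for j by (auto simp: opposite_end_def min_def max_def)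
  then show ?thesis unfolding row_pairs_def sum.reindex[OF inj] by simp
qed

lemma ip_off_diag_row:
  assumes "i < n"
  shows "ip n (off_diag_row (sym_ext x) i) v = (\<Sum>p\<in>row_pairs n i. v (opposite_end i p) * x p)"
proof -
  have "ip n (off_diag_row (sym_ext x) i) v = (\<Sum>j\<in>{..<n} - {i}. v j * x (min i j, max i j))"
    unfolding ip_def off_diag_row_def sym_ext_def using assms
    by (subst sum.remove[of _ i]) (auto intro!: sum.cong)
  then show ?thesis by (simp add: sum_row_pairs[where f="\<lambda>j p. v j * x p"])
qed

lemma sum_row_pairs_square_le:
  "(\<Sum>p\<in>row_pairs n i. (v (opposite_end i p))\<^sup>2) \<le> (nrm n v)\<^sup>2"
proof -
  have "(\<Sum>p\<in>row_pairs n i. (v (opposite_end i p))\<^sup>2) = (\<Sum>j\<in>{..<n} - {i}. (v j)\<^sup>2)"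
    by (rule sum_row_pairs[where f="\<lambda>j p. (v j)\<^sup>2"])
  also have "\<dots> \<le> (\<Sum>j<n. (v j)\<^sup>2)" by (rule sum_mono2) auto
  finally show ?thesis by (simp add: nrm_def L2_set_def sum_nonneg)
qed

lemma sum_upper_pairs:
  fixes f :: "nat \<Rightarrow> nat \<Rightarrow> real"
  shows "(\<Sum>i<n. \<Sum>j<n. f i j)
    = (\<Sum>(a, b)\<in>upper_pairs n. if a = b then f a a else f a b + f b a)"
proof (induction n)
  case 0
  then show ?case by (simp add: upper_pairs_def)
next
  case (Suc n)
  let ?g = "\<lambda>(a, b). if a = b then f a a else f a b + f b a"
  have split: "upper_pairs (Suc n) = upper_pairs n \<union> (\<lambda>i. (i, n)) ` {..n}"
    by (auto simp: upper_pairs_def less_Suc_eq)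
  have "sum ?g (upper_pairs (Suc n)) = sum ?g (upper_pairs n) + sum ?g ((\<lambda>i. (i, n)) ` {..n})"
    unfolding split by (rule sum.union_disjoint[OF finite_upper_pairs]) (auto simp: upper_pairs_def)
  also have "sum ?g ((\<lambda>i. (i, n)) ` {..n}) = (\<Sum>i\<le>n. ?g (i, n))"
    by (subst sum.reindex) (auto simp: inj_on_def)
  also have "\<dots> = (\<Sum>i<n. f i n + f n i) + f n n"
    unfolding lessThan_Suc_atMost[symmetric] sum.lessThan_Suc
    by (intro arg_cong2[where f="(+)"] sum.cong) auto
  finally show ?case using Suc by (simp add: sum.distrib)
qed

lemma ip_mv_sym_ext:
  "ip n x (mv n (sym_ext X) y)
    = (\<Sum>p\<in>upper_pairs n. (case p of (a, b) \<Rightarrow> if a = b then x a * y a else x a * y b + x b * y a) * X p)"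
proof -
  have "ip n x (mv n (sym_ext X) y) = (\<Sum>i<n. \<Sum>j<n. x i * y j * sym_ext X i j)"
    by (simp add: ip_def mv_def sum_distrib_left mult_ac)
  also have "\<dots> = (\<Sum>(a, b)\<in>upper_pairs n. if a = b then x a * y a * sym_ext X a a
      else x a * y b * sym_ext X a b + x b * y a * sym_ext X b a)"
    by (rule sum_upper_pairs)
  also have "\<dots> = (\<Sum>p\<in>upper_pairs n.
      (case p of (a, b) \<Rightarrow> if a = b then x a * y a else x a * y b + x b * y a) * X p)"
    by (rule sum.cong) (auto simp: upper_pairs_def sym_ext_def algebra_simps)
  finally show ?thesis .
qed

text \<open>
  Two entries of a symmetric matrix share one Gaussian variable, which costs the factor 2 by
  \<open>(p + q)\<^sup>2 \<le> 2 * (p\<^sup>2 + q\<^sup>2)\<close>.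
\<close>

lemma sum_upper_pairs_square_le:
  "(\<Sum>p\<in>upper_pairs n. (case p of (a, b) \<Rightarrow> if a = b then x a * y a else x a * y b + x b * y a)\<^sup>2)
    \<le> 2 * ((nrm n x)\<^sup>2 * (nrm n y)\<^sup>2)"
proof -
  have "(\<Sum>p\<in>upper_pairs n. (case p of (a, b) \<Rightarrow> if a = b then x a * y a else x a * y b + x b * y a)\<^sup>2)
    \<le> (\<Sum>p\<in>upper_pairs n. 2 * (case p of (a, b) \<Rightarrow>
          if a = b then (x a * y a)\<^sup>2 else (x a * y b)\<^sup>2 + (x b * y a)\<^sup>2))"
  proof (rule sum_mono)
    fix p assume "p \<in> upper_pairs n"
    have "(x a * y b + x b * y a)\<^sup>2 \<le> 2 * ((x a * y b)\<^sup>2 + (x b * y a)\<^sup>2)" for a b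
      using sum_squares_bound[of "x a * y b" "x b * y a"] by (simp add: power2_sum)
    then show "(case p of (a, b) \<Rightarrow> if a = b then x a * y a else x a * y b + x b * y a)\<^sup>2
        \<le> 2 * (case p of (a, b) \<Rightarrow> if a = b then (x a * y a)\<^sup>2 else (x a * y b)\<^sup>2 + (x b * y a)\<^sup>2)"
      by (cases p) simp
  qed
  also have "\<dots> = 2 * (\<Sum>i<n. \<Sum>j<n. (x i * y j)\<^sup>2)"
    unfolding sum_distrib_left[symmetric] sum_upper_pairs[where f="\<lambda>i j. (x i * y j)\<^sup>2"] by simp
  also have "(\<Sum>i<n. \<Sum>j<n. (x i * y j)\<^sup>2) = (\<Sum>i<n. (x i)\<^sup>2) * (\<Sum>j<n. (y j)\<^sup>2)"
    by (simp add: sum_product power_mult_distrib)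
  finally show ?thesis by (simp add: nrm_def L2_set_def sum_nonneg)
qed

text \<open>
  Powers of the cleared matrix read no entry of row \<open>i\<close>. Being also measurable in the entries they
  do read, they are admissible random coefficients for the entries of that row.
\<close>

lemma mv_power_leave_out_restrict:
  assumes "i < n" "a < n"
  shows "(mv n (leave_out (sym_ext (restrict x (upper_pairs n - row_pairs n i))) i) ^^ k) v a
       = (mv n (leave_out (sym_ext x) i) ^^ k) v a"
  using assms(2)
proof (induction k arbitrary: a)
  case (Suc k)
  have entry: "leave_out (sym_ext (restrict x (upper_pairs n - row_pairs n i))) i a b
      = leave_out (sym_ext x) i a b" if "b < n" for b
  proof -
    have "(min a b, max a b) \<in> upper_pairs n - row_pairs n i" if "a \<noteq> i" "b \<noteq> i"
      using Suc.prems \<open>b < n\<close> that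
      by (auto simp: upper_pairs_def row_pairs_def min_def max_def split: if_splits)
    then show ?thesis by (simp add: leave_out_def sym_ext_def)
  qed
  have "(mv n N ^^ Suc k) v a = (\<Sum>j<n. N a j * (mv n N ^^ k) v j)" for N
    by (simp add: mv_def[of n N "(mv n N ^^ k) v"])
  note step = this
  show ?case unfolding step by (rule sum.cong[OF refl]) (simp only: lessThan_iff entry Suc.IH)
qed simp

lemma borel_measurable_mv_power_leave_out:
  assumes "i < n" "a < n"
  shows "(\<lambda>z. (mv n (leave_out (sym_ext z) i) ^^ k) v a)
    \<in> borel_measurable (PiM (upper_pairs n - row_pairs n i) (\<lambda>_. borel))"
  using assms(2)
proof (induction k arbitrary: a)
  case (Suc k)
  have entry: "(\<lambda>z. leave_out (sym_ext z) i a b)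
      \<in> borel_measurable (PiM (upper_pairs n - row_pairs n i) (\<lambda>_. borel))" if "b < n" for b
  proof (cases "a = i \<or> b = i")
    case True then show ?thesis by (simp add: leave_out_def)
  next
    case False
    then have "(min a b, max a b) \<in> upper_pairs n - row_pairs n i"
      using Suc.prems \<open>b < n\<close>
      by (auto simp: upper_pairs_def row_pairs_def min_def max_def split: if_splits)
    then show ?thesis using False
      by (simp add: leave_out_def sym_ext_def measurable_component_singleton)
  qed
  show ?case
    unfolding funpow.simps o_apply mv_def[of n _ "(mv n _ ^^ k) v"]
    by (intro borel_measurable_sum borel_measurable_times entry Suc.IH) auto
qed simp

locale gaussian_noise = prob_space M for M :: "'a measure" +
  fixes n :: nat and X :: "nat \<times> nat \<Rightarrow> 'a \<Rightarrow> real" and \<tau> :: real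
  assumes n_pos: "0 < n" and tau_pos: "0 < \<tau>"
    and indep: "indep_vars (\<lambda>_. borel) X (upper_pairs n)"
    and normal: "\<And>p. p \<in> upper_pairs n \<Longrightarrow>
      distributed M lborel (X p) (\<lambda>x. ennreal (normal_density 0 \<tau> x))"
begin

definition W :: "'a \<Rightarrow> nat \<Rightarrow> nat \<Rightarrow> real" where
  "W \<omega> = sym_ext (\<lambda>p. X p \<omega>)"

lemma linear_tail:
  assumes "J \<subseteq> upper_pairs n" "(\<Sum>p\<in>J. (a p)\<^sup>2) \<le> s" "0 < s" "0 \<le> t"
  shows "prob {\<omega> \<in> space M. t \<le> (\<Sum>p\<in>J. a p * X p \<omega>)} \<le> exp (- t\<^sup>2 / (2 * \<tau>\<^sup>2 * s))"
    and "{\<omega> \<in> space M. t \<le> (\<Sum>p\<in>J. a p * X p \<omega>)} \<in> events"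
proof -
  show "prob {\<omega> \<in> space M. t \<le> (\<Sum>p\<in>J. a p * X p \<omega>)} \<le> exp (- t\<^sup>2 / (2 * \<tau>\<^sup>2 * s))"
    using assms normal tau_pos finite_subset[OF assms(1)]
    by (intro gaussian_sum_tail indep_vars_subset[OF indep]) auto
  have "X p \<in> borel_measurable M" if "p \<in> J" for p
    using indep assms(1) that by (auto simp: indep_vars_def)
  then show "{\<omega> \<in> space M. t \<le> (\<Sum>p\<in>J. a p * X p \<omega>)} \<in> events"
    by (intro borel_measurable_le borel_measurable_const borel_measurable_sum borel_measurable_times)
qed

text \<open>
  For two grid points the bilinear form is Gaussian with variance at most \<open>2 * \<tau>\<^sup>2\<close>, so it exceeds
  \<open>12 * \<tau> * sqrt n\<close> with probability at most \<open>exp (- 36 * n)\<close>. There are at most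
  \<open>2 ^ (36 * n)\<close> pairs of grid points, and \<open>2 < exp 1\<close>.
\<close>

lemma operator_norm_event:
  obtains F where "F \<in> events" "prob F \<le> 2 ^ (36 * n) * exp (- 36 * real n)"
    "\<And>\<omega>. \<omega> \<in> space M \<Longrightarrow> \<omega> \<notin> F \<Longrightarrow> form_bounded n (W \<omega>) (24 * \<tau> * sqrt n)"
proof -
  define t where "t = 12 * \<tau> * sqrt n"
  define f where "f z z' p = (case p of (a, b) \<Rightarrow> if a = b then grid_point n z a * grid_point n z' a
      else grid_point n z a * grid_point n z' b + grid_point n z b * grid_point n z' a)" for z z' p
  define E where "E q = {\<omega> \<in> space M. t \<le> (\<Sum>p\<in>upper_pairs n. f (fst q) (snd q) p * X p \<omega>)}" for q
  define F where "F = (\<Union>q\<in>grid n \<times> grid n. E q)"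
  have t0: "0 \<le> t" using tau_pos by (simp add: t_def)
  have ip: "ip n (grid_point n z) (mv n (W \<omega>) (grid_point n z')) = (\<Sum>p\<in>upper_pairs n. f z z' p * X p \<omega>)"
    for z z' \<omega>
    unfolding W_def ip_mv_sym_ext f_def ..
  have sq: "(\<Sum>p\<in>upper_pairs n. (f (fst q) (snd q) p)\<^sup>2) \<le> 2" if "q \<in> grid n \<times> grid n" for q
  proof -
    have "(\<Sum>p\<in>upper_pairs n. (f (fst q) (snd q) p)\<^sup>2)
      \<le> 2 * ((nrm n (grid_point n (fst q)))\<^sup>2 * (nrm n (grid_point n (snd q)))\<^sup>2)"
      unfolding f_def by (rule sum_upper_pairs_square_le)
    also have "\<dots> \<le> 2 * (1 * 1)"
      using that nrm_grid_point_le[OF n_pos] by (intro mult_left_mono mult_mono power_le_one) auto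
    finally show ?thesis by simp
  qed
  have E: "E q \<in> events" "prob (E q) \<le> exp (- 36 * real n)" if "q \<in> grid n \<times> grid n" for q
  proof -
    have "- t\<^sup>2 / (2 * \<tau>\<^sup>2 * 2) = - 36 * real n"
      using tau_pos by (simp add: t_def power_mult_distrib)
    then show "prob (E q) \<le> exp (- 36 * real n)"
      using linear_tail(1)[OF order.refl sq[OF that] _ t0] unfolding E_def by simp
    show "E q \<in> events" unfolding E_def by (rule linear_tail(2)[OF order.refl sq[OF that] _ t0]) simp
  qed
  have fin: "finite (grid n \<times> grid n)" by (simp add: card_grid)
  show thesis
  proof
    show "F \<in> events" unfolding F_def using fin E(1) by (intro sets.finite_UN) auto
    have "prob F \<le> (\<Sum>q\<in>grid n \<times> grid n. prob (E q))"
      unfolding F_def by (rule finite_measure_subadditive_finite[OF fin]) (use E(1) in auto)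
    also have "\<dots> \<le> (\<Sum>q\<in>grid n \<times> grid n. exp (- 36 * real n))" by (intro sum_mono E(2))
    also have "\<dots> = (real (card (grid n)) * real (card (grid n))) * exp (- 36 * real n)"
      by (simp add: card_cartesian_product)
    also have "\<dots> \<le> (2 ^ (18 * n) * 2 ^ (18 * n)) * exp (- 36 * real n)"
      using card_grid(2) by (intro mult_right_mono mult_mono) auto
    also have "\<dots> = 2 ^ (36 * n) * exp (- 36 * real n)" by (simp flip: power_add)
    finally show "prob F \<le> 2 ^ (36 * n) * exp (- 36 * real n)" .
  next
    fix \<omega> assume \<omega>: "\<omega> \<in> space M" "\<omega> \<notin> F"
    have "form_bounded n (W \<omega>) (2 * t)"
    proof (rule form_bounded_of_grid[OF n_pos])
      fix z z' assume z: "z \<in> grid n" "z' \<in> grid n"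
      \<comment> \<open>the grid is symmetric, so one-sided bounds suffice\<close>
      let ?m = "\<lambda>i\<in>{..<n}. - z i"
      have m: "?m \<in> grid n" using z(1) by (simp add: grid_def)
      have "ip n (grid_point n ?m) v = - ip n (grid_point n z) v" for v
        by (simp add: ip_def grid_point_def sum_negf)
      moreover have "ip n (grid_point n y) (mv n (W \<omega>) (grid_point n z')) < t" if "y \<in> grid n" for y
      proof -
        have "\<omega> \<notin> E (y, z')" using \<omega> that z(2) by (auto simp: F_def)
        then show ?thesis using \<omega> by (simp add: E_def ip)
      qed
      note this[OF z(1)] this[OF m]
      ultimately show "\<bar>ip n (grid_point n z) (mv n (W \<omega>) (grid_point n z'))\<bar> \<le> t"
        by (simp add: abs_le_iff)
    qed
    then show "form_bounded n (W \<omega>) (24 * \<tau> * sqrt n)" by (simp add: t_def mult.assoc)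
  qed
qed

text \<open>
  The first-order term of the expansion. This event decides the recovery threshold: its probability
  has to be \<open>o(1 / n)\<close>.
\<close>

lemma row_event:
  assumes sig: "\<And>j. j < n \<Longrightarrow> \<sigma> j \<in> {1, -1}" and i: "i < n" and th: "0 \<le> \<theta>"
  obtains F where "F \<in> events" "prob F \<le> exp (- \<theta>\<^sup>2 / (2 * \<tau>\<^sup>2 * real n))"
    "\<And>\<omega>. \<omega> \<in> space M \<Longrightarrow> \<omega> \<notin> F \<Longrightarrow> - \<theta> \<le> \<sigma> i * ip n (off_diag_row (W \<omega>) i) \<sigma>"
proof -
  let ?v = "\<lambda>j. - \<sigma> i * \<sigma> j"
  define F where "F = {\<omega> \<in> space M. \<theta> \<le> (\<Sum>p\<in>row_pairs n i. ?v (opposite_end i p) * X p \<omega>)}"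
  have "nrm n ?v = sqrt n"
  proof (rule nrm_sign)
    fix j assume "j < n"
    then show "?v j \<in> {1, -1}" using sig[OF i] sig[of j] by auto
  qed
  then have sq: "(\<Sum>p\<in>row_pairs n i. (?v (opposite_end i p))\<^sup>2) \<le> real n"
    using sum_row_pairs_square_le[of ?v i n] by simp
  show thesis
  proof
    show "F \<in> events" unfolding F_def
      by (rule linear_tail(2)[OF row_pairs_subset[OF i] sq _ th]) (use n_pos in simp)
    show "prob F \<le> exp (- \<theta>\<^sup>2 / (2 * \<tau>\<^sup>2 * real n))" unfolding F_def
      by (rule linear_tail(1)[OF row_pairs_subset[OF i] sq _ th]) (use n_pos in simp)
  next
    fix \<omega> assume "\<omega> \<in> space M" "\<omega> \<notin> F"
    then have "ip n (off_diag_row (W \<omega>) i) ?v < \<theta>"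
      unfolding W_def ip_off_diag_row[OF i] by (simp add: F_def)
    then show "- \<theta> \<le> \<sigma> i * ip n (off_diag_row (W \<omega>) i) \<sigma>"
      unfolding ip_scale_right by simp
  qed
qed

text \<open>
  The coefficient vector \<open>(leave_out W i)\<^sup>k v\<close> has length at most \<open>\<rho> ^ k * sqrt n\<close> once the operator
  norm bound holds, so the threshold is \<open>t\<close> conditional standard deviations. The failure event
  includes this length bound, so its probability is controlled without conditioning on the norm of \<open>W\<close>,
  which would destroy the independence between row \<open>i\<close> and the cleared matrix.
\<close>

lemma one_sided_power_event:
  assumes sig: "nrm n v = sqrt n" and i: "i < n" and t: "0 \<le> t" and rho: "0 < \<rho>"
  obtains F where "F \<in> events" "prob F \<le> exp (- t\<^sup>2 / 2)"
    "\<And>\<omega>. \<omega> \<in> space M \<Longrightarrow> \<omega> \<notin> F \<Longrightarrow> form_bounded n (W \<omega>) \<rho> \<Longrightarrow>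
       ip n (off_diag_row (W \<omega>) i) ((mv n (leave_out (W \<omega>) i) ^^ k) v) \<le> t * \<tau> * \<rho> ^ k * sqrt n"
proof -
  let ?K = "upper_pairs n - row_pairs n i"
  define a where "a z p = (mv n (leave_out (sym_ext z) i) ^^ k) v (opposite_end i p)" for z p
  define T where "T = t * \<tau> * \<rho> ^ k * sqrt n"
  define s where "s = (\<rho> ^ k * sqrt n)\<^sup>2"
  define F where "F = {\<omega> \<in> space M. T \<le> (\<Sum>p\<in>row_pairs n i. a (\<lambda>q\<in>?K. X q \<omega>) p * X p \<omega>)
            \<and> (\<Sum>p\<in>row_pairs n i. (a (\<lambda>q\<in>?K. X q \<omega>) p)\<^sup>2) \<le> s}"
  have T: "0 \<le> T" using t tau_pos rho by (simp add: T_def)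
  have s: "0 < s" using rho n_pos by (simp add: s_def)
  have opposite_end: "opposite_end i p < n" if "p \<in> row_pairs n i" for p
    using that i by (auto simp: row_pairs_def opposite_end_def)
  have meas: "(\<lambda>z. a z p) \<in> borel_measurable (PiM ?K (\<lambda>_. borel))" if "p \<in> row_pairs n i" for p
    unfolding a_def by (rule borel_measurable_mv_power_leave_out[OF i opposite_end[OF that]])
  note tail = gaussian_sum_tail_random_coefficients[where a=a, OF finite_upper_pairs indep normal tau_pos
      row_pairs_subset[OF i] meas s T]
  define c where "c = \<rho> ^ k * sqrt n"
  have "0 < c" "T = t * \<tau> * c" "s = c\<^sup>2" using rho n_pos by (simp_all add: c_def T_def s_def)
  then have bound: "- T\<^sup>2 / (2 * \<tau>\<^sup>2 * s) = - t\<^sup>2 / 2"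
    using tau_pos by (simp add: power2_eq_square)
  have F: "F \<in> events" "prob F \<le> exp (- t\<^sup>2 / 2)"
    using tail unfolding F_def bound by simp_all
  show thesis
  proof (rule that[OF F])
    fix \<omega> assume \<omega>: "\<omega> \<in> space M" "\<omega> \<notin> F" and bd: "form_bounded n (W \<omega>) \<rho>"
    let ?w = "(mv n (leave_out (W \<omega>) i) ^^ k) v"
    have a: "a (\<lambda>q\<in>?K. X q \<omega>) p = ?w (opposite_end i p)" if "p \<in> row_pairs n i" for p
      unfolding a_def W_def by (rule mv_power_leave_out_restrict[OF i opposite_end[OF that]])
    have "(\<Sum>p\<in>row_pairs n i. (?w (opposite_end i p))\<^sup>2) \<le> (nrm n ?w)\<^sup>2" by (rule sum_row_pairs_square_le)
    also have "\<dots> \<le> s"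
      unfolding s_def sig[symmetric] using rho
      by (intro power_mono nrm_mv_power_le form_bounded_leave_out[OF bd]) auto
    finally have "(\<Sum>p\<in>row_pairs n i. (a (\<lambda>q\<in>?K. X q \<omega>) p)\<^sup>2) \<le> s" by (simp add: a)
    then have "(\<Sum>p\<in>row_pairs n i. a (\<lambda>q\<in>?K. X q \<omega>) p * X p \<omega>) < T"
      using \<omega> by (auto simp: F_def)
    then have "(\<Sum>p\<in>row_pairs n i. ?w (opposite_end i p) * X p \<omega>) < T" by (simp add: a)
    moreover have "ip n (off_diag_row (W \<omega>) i) ?w = (\<Sum>p\<in>row_pairs n i. ?w (opposite_end i p) * X p \<omega>)"
      unfolding W_def by (rule ip_off_diag_row[OF i])
    ultimately show "ip n (off_diag_row (W \<omega>) i) ?w \<le> t * \<tau> * \<rho> ^ k * sqrt n" by (simp add: T_def)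
  qed
qed

lemma power_event:
  assumes sig: "\<And>j. j < n \<Longrightarrow> \<sigma> j \<in> {1, -1}" and i: "i < n" and t: "0 \<le> t" and rho: "0 < \<rho>"
  obtains F where "F \<in> events" "prob F \<le> 2 * exp (- t\<^sup>2 / 2)"
    "\<And>\<omega>. \<omega> \<in> space M \<Longrightarrow> \<omega> \<notin> F \<Longrightarrow> form_bounded n (W \<omega>) \<rho> \<Longrightarrow>
       \<bar>ip n (off_diag_row (W \<omega>) i) ((mv n (leave_out (W \<omega>) i) ^^ k) \<sigma>)\<bar> \<le> t * \<tau> * \<rho> ^ k * sqrt n"
proof -
  have n1: "nrm n \<sigma> = sqrt n" by (rule nrm_sign[OF sig])
  have n2: "nrm n (\<lambda>j. - \<sigma> j) = sqrt n" using n1 by (simp add: nrm_def L2_set_def)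
  obtain F where F: "F \<in> events" "prob F \<le> exp (- t\<^sup>2 / 2)"
    "\<And>\<omega>. \<omega> \<in> space M \<Longrightarrow> \<omega> \<notin> F \<Longrightarrow> form_bounded n (W \<omega>) \<rho> \<Longrightarrow>
       ip n (off_diag_row (W \<omega>) i) ((mv n (leave_out (W \<omega>) i) ^^ k) \<sigma>) \<le> t * \<tau> * \<rho> ^ k * sqrt n"
    using one_sided_power_event[OF n1 i t rho, of k] by blast
  obtain G where G: "G \<in> events" "prob G \<le> exp (- t\<^sup>2 / 2)"
    "\<And>\<omega>. \<omega> \<in> space M \<Longrightarrow> \<omega> \<notin> G \<Longrightarrow> form_bounded n (W \<omega>) \<rho> \<Longrightarrow>
       ip n (off_diag_row (W \<omega>) i) ((mv n (leave_out (W \<omega>) i) ^^ k) (\<lambda>j. - \<sigma> j)) \<le> t * \<tau> * \<rho> ^ k * sqrt n"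
    using one_sided_power_event[OF n2 i t rho, of k] by blast
  show thesis
  proof
    show "F \<union> G \<in> events" using F G by simp
    show "prob (F \<union> G) \<le> 2 * exp (- t\<^sup>2 / 2)"
      using measure_Un_le[OF F(1) G(1)] F(2) G(2) by simp
  next
    fix \<omega> assume \<omega>: "\<omega> \<in> space M" "\<omega> \<notin> F \<union> G" "form_bounded n (W \<omega>) \<rho>"
    then show "\<bar>ip n (off_diag_row (W \<omega>) i) ((mv n (leave_out (W \<omega>) i) ^^ k) \<sigma>)\<bar> \<le> t * \<tau> * \<rho> ^ k * sqrt n"
      using F(3)[of \<omega>] G(3)[of \<omega>]
        ip_scale_right[of n "off_diag_row (W \<omega>) i" "-1" "(mv n (leave_out (W \<omega>) i) ^^ k) \<sigma>"]
      by (simp add: mv_power_uminus abs_le_iff)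
  qed
qed

lemma good_event:
  assumes sig: "\<And>j. j < n \<Longrightarrow> \<sigma> j \<in> {1, -1}" and th: "0 \<le> \<theta>" and t: "0 \<le> t"
    and rho: "\<rho> = 24 * \<tau> * sqrt n"
  obtains F where "F \<in> events"
    "prob F \<le> 2 ^ (36 * n) * exp (- 36 * real n) + n * exp (- \<theta>\<^sup>2 / (2 * \<tau>\<^sup>2 * real n))
       + 2 * (real n)\<^sup>2 * exp (- t\<^sup>2 / 2)"
    "\<And>\<omega>. \<omega> \<in> space M \<Longrightarrow> \<omega> \<notin> F \<Longrightarrow> form_bounded n (W \<omega>) \<rho>"
    "\<And>\<omega> i. \<omega> \<in> space M \<Longrightarrow> \<omega> \<notin> F \<Longrightarrow> i < n \<Longrightarrow> - \<theta> \<le> \<sigma> i * ip n (off_diag_row (W \<omega>) i) \<sigma>"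
    "\<And>\<omega> i k. \<omega> \<in> space M \<Longrightarrow> \<omega> \<notin> F \<Longrightarrow> i < n \<Longrightarrow> k < n \<Longrightarrow>
       \<bar>ip n (off_diag_row (W \<omega>) i) ((mv n (leave_out (W \<omega>) i) ^^ k) \<sigma>)\<bar> \<le> t * \<tau> * \<rho> ^ k * sqrt n"
proof -
  have rho0: "0 < \<rho>" using rho tau_pos n_pos by simp
  obtain F where F: "F \<in> events" "prob F \<le> 2 ^ (36 * n) * exp (- 36 * real n)"
    "\<And>\<omega>. \<omega> \<in> space M \<Longrightarrow> \<omega> \<notin> F \<Longrightarrow> form_bounded n (W \<omega>) \<rho>"
    using operator_norm_event unfolding rho by blast
  have "\<forall>i\<in>{..<n}. \<exists>G. G \<in> events \<and> prob G \<le> exp (- \<theta>\<^sup>2 / (2 * \<tau>\<^sup>2 * real n)) \<and>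
    (\<forall>\<omega>\<in>space M. \<omega> \<notin> G \<longrightarrow> - \<theta> \<le> \<sigma> i * ip n (off_diag_row (W \<omega>) i) \<sigma>)"
  proof
    fix i assume "i \<in> {..<n}" then have i: "i < n" by simp
    show "\<exists>G. G \<in> events \<and> prob G \<le> exp (- \<theta>\<^sup>2 / (2 * \<tau>\<^sup>2 * real n)) \<and>
      (\<forall>\<omega>\<in>space M. \<omega> \<notin> G \<longrightarrow> - \<theta> \<le> \<sigma> i * ip n (off_diag_row (W \<omega>) i) \<sigma>)"
      by (rule row_event[OF sig i th]) blast+
  qed
  then obtain G where G: "\<And>i. i < n \<Longrightarrow> G i \<in> events"
    "\<And>i. i < n \<Longrightarrow> prob (G i) \<le> exp (- \<theta>\<^sup>2 / (2 * \<tau>\<^sup>2 * real n))"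
    "\<And>i \<omega>. i < n \<Longrightarrow> \<omega> \<in> space M \<Longrightarrow> \<omega> \<notin> G i \<Longrightarrow> - \<theta> \<le> \<sigma> i * ip n (off_diag_row (W \<omega>) i) \<sigma>"
    unfolding bchoice_iff by (auto simp: Ball_def)
  let ?Q = "\<lambda>q H. H \<in> events \<and> prob H \<le> 2 * exp (- t\<^sup>2 / 2) \<and>
    (\<forall>\<omega>\<in>space M. \<omega> \<notin> H \<longrightarrow> form_bounded n (W \<omega>) \<rho> \<longrightarrow>
      \<bar>ip n (off_diag_row (W \<omega>) (fst q)) ((mv n (leave_out (W \<omega>) (fst q)) ^^ snd q) \<sigma>)\<bar>
        \<le> t * \<tau> * \<rho> ^ snd q * sqrt n)"
  have "\<forall>q\<in>{..<n} \<times> {..<n}. \<exists>H. ?Q q H"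
  proof
    fix q assume "q \<in> {..<n} \<times> {..<n}" then have i: "fst q < n" by auto
    show "\<exists>H. ?Q q H"
      by (rule power_event[OF sig i t rho0, where k="snd q"]) blast+
  qed
  from bchoice[OF this] obtain H where Q: "\<forall>q\<in>{..<n} \<times> {..<n}. ?Q q (H q)" by (rule exE)
  have H: "H q \<in> events" "prob (H q) \<le> 2 * exp (- t\<^sup>2 / 2)" if "q \<in> {..<n} \<times> {..<n}" for q
    using bspec[OF Q that] by auto
  have H_bound: "\<bar>ip n (off_diag_row (W \<omega>) i) ((mv n (leave_out (W \<omega>) i) ^^ k) \<sigma>)\<bar> \<le> t * \<tau> * \<rho> ^ k * sqrt n"
    if "i < n" "k < n" "\<omega> \<in> space M" "\<omega> \<notin> H (i, k)" "form_bounded n (W \<omega>) \<rho>" for i k \<omega>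
    using bspec[OF Q, of "(i, k)"] that by auto
  define GG where "GG = (\<Union>i<n. G i)"
  define HH where "HH = (\<Union>q\<in>{..<n} \<times> {..<n}. H q)"
  have GG: "GG \<in> events" unfolding GG_def using G(1) by (intro sets.finite_UN) auto
  have HH: "HH \<in> events" unfolding HH_def using H(1) by (intro sets.finite_UN) auto
  have pG: "prob GG \<le> n * exp (- \<theta>\<^sup>2 / (2 * \<tau>\<^sup>2 * real n))"
  proof -
    have "prob GG \<le> (\<Sum>i<n. prob (G i))"
      unfolding GG_def by (rule finite_measure_subadditive_finite) (use G(1) in auto)
    also have "\<dots> \<le> (\<Sum>i<n. exp (- \<theta>\<^sup>2 / (2 * \<tau>\<^sup>2 * real n)))"
      by (intro sum_mono G(2)) auto
    finally show ?thesis by simp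
  qed
  have pH: "prob HH \<le> 2 * (real n)\<^sup>2 * exp (- t\<^sup>2 / 2)"
  proof -
    have "prob HH \<le> (\<Sum>q\<in>{..<n} \<times> {..<n}. prob (H q))"
      unfolding HH_def by (rule finite_measure_subadditive_finite) (use H(1) in auto)
    also have "\<dots> \<le> (\<Sum>q\<in>{..<n} \<times> {..<n}. 2 * exp (- t\<^sup>2 / 2))"
      by (intro sum_mono H(2))
    finally show ?thesis by (simp add: card_cartesian_product power2_eq_square)
  qed
  show thesis
  proof
    show "F \<union> GG \<union> HH \<in> events" using F GG HH by simp
    have "prob (F \<union> GG \<union> HH) \<le> prob F + prob GG + prob HH"
      using measure_Un_le[OF sets.Un[OF F(1) GG] HH] measure_Un_le[OF F(1) GG] by linarith
    then show "prob (F \<union> GG \<union> HH) \<le> 2 ^ (36 * n) * exp (- 36 * real n)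
        + n * exp (- \<theta>\<^sup>2 / (2 * \<tau>\<^sup>2 * real n)) + 2 * (real n)\<^sup>2 * exp (- t\<^sup>2 / 2)"
      using F(2) pG pH by linarith
  next
    fix \<omega> assume \<omega>: "\<omega> \<in> space M" "\<omega> \<notin> F \<union> GG \<union> HH"
    then show bd: "form_bounded n (W \<omega>) \<rho>" using F(3) by blast
    fix i assume i: "i < n"
    show "- \<theta> \<le> \<sigma> i * ip n (off_diag_row (W \<omega>) i) \<sigma>"
      using \<omega> i G(3)[OF i] by (auto simp: GG_def)
    fix k assume k: "k < n"
    show "\<bar>ip n (off_diag_row (W \<omega>) i) ((mv n (leave_out (W \<omega>) i) ^^ k) \<sigma>)\<bar> \<le> t * \<tau> * \<rho> ^ k * sqrt n"
      using \<omega> i k by (intro H_bound bd) (auto simp: HH_def)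
  qed
qed

end

section \<open>Recovery at a fixed size\<close>

text \<open>
  The eigenvalue \<open>lam\<close> is known only through the lower bound \<open>l\<close>; all terms shrink as \<open>lam\<close> grows, so the
  estimate is uniform in it.
\<close>

lemma row_series_lower_bound:
  fixes q :: "nat \<Rightarrow> real"
  assumes K: "0 < K" and lam: "0 < l" "l \<le> lam" and rho: "0 \<le> \<rho>" "4 * \<rho> \<le> l"
    and b: "0 \<le> b" and th: "0 \<le> \<theta>"
    and s: "s \<in> {1, -1}" and q0: "- \<theta> \<le> s * q 0"
    and q: "\<And>k. k < K \<Longrightarrow> \<bar>q k\<bar> \<le> b * \<rho> ^ k"
  shows "1 - \<theta> / l - 2 * b * \<rho> / l\<^sup>2 \<le> 1 + s * (\<Sum>k<K. q k / lam ^ Suc k)"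
proof -
  obtain m where m: "K = Suc m" using K gr0_implies_Suc by blast
  have lam0: "0 < lam" using lam by simp
  have quarter: "\<rho> / lam \<le> 1/4" "0 \<le> \<rho> / lam" using rho lam lam0 by (auto simp: field_simps)
  define R where "R = (\<Sum>k<m. q (Suc k) / lam ^ Suc (Suc k))"
  have split: "(\<Sum>k<K. q k / lam ^ Suc k) = q 0 / lam + R"
    unfolding m R_def by (subst sum.lessThan_Suc_shift) simp
  have "\<bar>R\<bar> \<le> (\<Sum>k<m. \<bar>q (Suc k) / lam ^ Suc (Suc k)\<bar>)" unfolding R_def by (rule sum_abs)
  also have "\<dots> \<le> (\<Sum>k<m. b / lam * (\<rho> / lam) ^ Suc k)"
  proof (rule sum_mono)
    fix k assume "k \<in> {..<m}"
    then have "\<bar>q (Suc k)\<bar> / lam ^ Suc (Suc k) \<le> b * \<rho> ^ Suc k / lam ^ Suc (Suc k)"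
      using q[of "Suc k"] lam0 by (intro divide_right_mono) (auto simp: m)
    also have "\<dots> = b / lam * (\<rho> / lam) ^ Suc k" by (simp add: power_divide)
    finally show "\<bar>q (Suc k) / lam ^ Suc (Suc k)\<bar> \<le> b / lam * (\<rho> / lam) ^ Suc k"
      using lam0 by (simp add: abs_mult)
  qed
  also have "\<dots> = b / lam * (\<Sum>k<m. (\<rho> / lam) ^ Suc k)" by (simp add: sum_distrib_left)
  also have "\<dots> \<le> b / lam * (2 * (\<rho> / lam))"
    using b lam0 quarter by (intro mult_left_mono geometric_quarter_le) auto
  also have "\<dots> = 2 * b * \<rho> / lam\<^sup>2" by (simp add: power2_eq_square)
  also have "\<dots> \<le> 2 * b * \<rho> / l\<^sup>2"
    using lam b rho lam0 by (intro divide_left_mono power_mono mult_nonneg_nonneg mult_pos_pos) auto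
  finally have R: "\<bar>R\<bar> \<le> 2 * b * \<rho> / l\<^sup>2" .
  have "- (\<theta> / l) \<le> - (\<theta> / lam)" using th lam lam0 by (simp add: divide_left_mono)
  also have "\<dots> \<le> s * q 0 / lam" using q0 lam0 by (simp add: field_simps)
  finally have "- (\<theta> / l) \<le> s * q 0 / lam" .
  moreover have "\<bar>s * R\<bar> = \<bar>R\<bar>" using s by auto
  ultimately show ?thesis using R unfolding split by (simp add: distrib_left)
qed

lemma agreement_ratio_eq_1:
  assumes n: "0 < n" and u: "u \<in> carrier_vec n" and sig: "\<And>i. i < n \<Longrightarrow> \<sigma> $ i \<in> {1, -1}"
    and pos: "\<And>i. i < n \<Longrightarrow> 0 < c * \<sigma> $ i * u $ i"
  shows "agreement_ratio n (sign_vec u) \<sigma> = 1"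
proof -
  have sgn: "sign_vec u $ i = sgn c * \<sigma> $ i" if "i < n" for i
  proof -
    have "sgn (c * \<sigma> $ i * u $ i) = 1" using pos[OF that] by simp
    then have "sgn c * \<sigma> $ i * sgn (u $ i) = 1"
      using sig[OF that] by (auto simp: sgn_mult)
    then have "sgn (u $ i) = sgn c * \<sigma> $ i"
      using sig[OF that] by (auto simp: sgn_if split: if_splits)
    then show ?thesis using u that by (simp add: sign_vec_def)
  qed
  have "c \<noteq> 0" using pos[OF n] by auto
  then have "sgn c = 1 \<or> sgn c = -1" by (auto simp: sgn_if)
  then consider "sgn c = 1" | "sgn c = -1" by blast
  then show ?thesis
  proof cases
    case 1
    have "(\<Sum>i<n. of_bool (sign_vec u $ i = \<sigma> $ i)) = (\<Sum>i<n. 1 :: real)"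
      using 1 sgn by (intro sum.cong) auto
    moreover have "(\<Sum>i<n. of_bool (- sign_vec u $ i = \<sigma> $ i)) = (\<Sum>i<n. 0 :: real)"
      using 1 sgn sig by (intro sum.cong) fastforce+
    ultimately show ?thesis using n unfolding agreement_ratio_def by simp
  next
    case 2
    have "(\<Sum>i<n. of_bool (- sign_vec u $ i = \<sigma> $ i)) = (\<Sum>i<n. 1 :: real)"
      using 2 sgn by (intro sum.cong) auto
    moreover have "(\<Sum>i<n. of_bool (sign_vec u $ i = \<sigma> $ i)) = (\<Sum>i<n. 0 :: real)"
      using 2 sgn sig by (intro sum.cong) fastforce+
    ultimately show ?thesis using n unfolding agreement_ratio_def by simp
  qed
qed

lemma mult_mat_vec_eq_mv:
  assumes "B \<in> carrier_mat n n" "u \<in> carrier_vec n" "i < n"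
  shows "(B *\<^sub>v u) $ i = mv n (\<lambda>i j. B $$ (i, j)) (\<lambda>j. u $ j) i"
  using assms by (simp add: mv_def scalar_prod_def atLeast0LessThan)

text \<open>
  The largest element of the spectrum is at least the maximum of the Rayleigh quotient, since that
  maximum is itself an eigenvalue.
\<close>

lemma rayleigh_le_largest_eigenvalue:
  assumes B: "B \<in> carrier_mat n n" and n: "0 < n"
    and sym: "symmetric_below n (\<lambda>i j. B $$ (i, j))"
  shows "ip n x (mv n (\<lambda>i j. B $$ (i, j)) x) \<le> largest_eigenvalue B * ip n x x"
proof -
  obtain m z where z: "ip n z z = 1" "\<And>i. i < n \<Longrightarrow> mv n (\<lambda>i j. B $$ (i, j)) z i = m * z i"
    and top: "\<And>x. ip n x (mv n (\<lambda>i j. B $$ (i, j)) x) \<le> m * ip n x x"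
    by (rule symmetric_top_eigenvector[OF sym n]) (rule that)
  let ?z = "vec n z"
  have zv: "mv n M (\<lambda>j. ?z $ j) = mv n M z" for M by (rule mv_cong) simp
  have "B *\<^sub>v ?z = m \<cdot>\<^sub>v ?z"
  proof (rule eq_vecI)
    show "(B *\<^sub>v ?z) $ i = (m \<cdot>\<^sub>v ?z) $ i" if "i < dim_vec (m \<cdot>\<^sub>v ?z)" for i
      using that mult_mat_vec_eq_mv[OF B, of ?z i] z(2) by (simp add: zv)
  qed (use B in auto)
  moreover have "?z \<noteq> 0\<^sub>v n"
  proof
    assume "?z = 0\<^sub>v n"
    then have "z i = 0" if "i < n" for i using that by (metis index_vec index_zero_vec(1))
    then have "ip n z z = 0" by (simp add: ip_def)
    then show False using z(1) by simp
  qed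
  ultimately have "m \<in> spectrum B"
    using B unfolding spectrum_def eigenvalue_def eigenvector_def by (auto intro!: exI[of _ ?z])
  then have "m \<le> largest_eigenvalue B"
    unfolding largest_eigenvalue_def using card_finite_spectrum(1)[OF B] by (intro Max_ge)
  then have "m * ip n x x \<le> largest_eigenvalue B * ip n x x"
    by (intro mult_right_mono) (simp_all add: ip_self)
  then show ?thesis using top[of x] by linarith
qed

lemma centered_adjacency_entry:
  assumes "A \<in> carrier_mat n n" "i < n" "j < n"
  shows "centered_adjacency n \<mu>\<^sub>1 \<mu>\<^sub>2 A $$ (i, j) = A $$ (i, j) - (\<mu>\<^sub>1 + \<mu>\<^sub>2) / 2"
proof -
  have n: "0 < n" using assms by simp
  have ones: "outer_product (normalized_ones n) (normalized_ones n) = mat n n (\<lambda>_. 1 / real n)"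
    by (rule eq_matI) (auto simp: outer_product_def normalized_ones_def)
  have "centered_adjacency n \<mu>\<^sub>1 \<mu>\<^sub>2 A $$ (i, j) = A $$ (i, j) - real n * (\<mu>\<^sub>1 + \<mu>\<^sub>2) / 2 * (1 / real n)"
    unfolding centered_adjacency_def ones using assms by simp
  also have "real n * (\<mu>\<^sub>1 + \<mu>\<^sub>2) / 2 * (1 / real n) = (\<mu>\<^sub>1 + \<mu>\<^sub>2) / 2"
    using n by simp
  finally show ?thesis .
qed

lemma centered_adjacency_carrier:
  "A \<in> carrier_mat n n \<Longrightarrow> centered_adjacency n \<mu>\<^sub>1 \<mu>\<^sub>2 A \<in> carrier_mat n n"
  unfolding centered_adjacency_def outer_product_def normalized_ones_def
  by (intro minus_carrier_mat smult_carrier_mat) simp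

text \<open>
  The deterministic core: on the event where the noise has small norm, no row cancels its label to
  first order, and all higher terms are small, the sign vector recovers the labels.
\<close>

lemma spiked_eigenvector_recovers:
  fixes \<sigma> :: "real vec" and W :: "nat \<Rightarrow> nat \<Rightarrow> real"
  assumes n: "0 < n" and B: "B \<in> carrier_mat n n"
    and spike: "\<And>i j. i < n \<Longrightarrow> j < n \<Longrightarrow> B $$ (i, j) = \<gamma> * \<sigma> $ i * \<sigma> $ j + W i j"
    and sig: "\<And>i. i < n \<Longrightarrow> \<sigma> $ i \<in> {1, -1}"
    and sym: "symmetric_below n W" and top: "top_unit_eigenvector B u"
    and bd: "form_bounded n W \<rho>"
    and l: "l = \<gamma> * n - \<rho>" "0 < l" and rho: "0 \<le> \<rho>" "4 * \<rho> \<le> l"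
    and b: "0 \<le> b" and th: "0 \<le> \<theta>"
    and first: "\<And>i. i < n \<Longrightarrow> - \<theta> \<le> \<sigma> $ i * ip n (off_diag_row W i) (\<lambda>j. \<sigma> $ j)"
    and higher: "\<And>i k. i < n \<Longrightarrow> k < n \<Longrightarrow>
      \<bar>ip n (off_diag_row W i) ((mv n (leave_out W i) ^^ k) (\<lambda>j. \<sigma> $ j))\<bar> \<le> b * \<rho> ^ k"
    and margin: "(1/4) ^ n * sqrt n < 1 - \<theta> / l - 2 * b * \<rho> / l\<^sup>2"
  shows "agreement_ratio n (sign_vec u) \<sigma> = 1"
proof -
  define lam where "lam = largest_eigenvalue B"
  define s where "s i = \<sigma> $ i" for i
  define v where "v i = u $ i" for i
  have u: "u \<in> carrier_vec n" "B *\<^sub>v u = lam \<cdot>\<^sub>v u" "u \<bullet> u = 1"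
    using top B unfolding top_unit_eigenvector_def eigenvector_def lam_def by auto
  have s: "s i \<in> {1, -1}" if "i < n" for i using sig[OF that] by (simp add: s_def)
  have mvB: "mv n (\<lambda>i j. B $$ (i, j)) x i = \<gamma> * ip n s x * s i + mv n W x i" if "i < n" for i x
  proof -
    have "mv n (\<lambda>i j. B $$ (i, j)) x i = (\<Sum>j<n. \<gamma> * s i * (s j * x j) + W i j * x j)"
      unfolding mv_def by (intro sum.cong) (use that spike in \<open>auto simp: s_def algebra_simps\<close>)
    also have "\<dots> = \<gamma> * s i * ip n s x + mv n W x i"
      by (simp add: sum.distrib sum_distrib_left mv_def ip_def)
    finally show ?thesis by simp
  qed
  have symB: "symmetric_below n (\<lambda>i j. B $$ (i, j))"
    using sym spike by (auto simp: symmetric_below_def)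
  have ns: "nrm n s = sqrt n" by (rule nrm_sign[OF s])
  then have ss: "ip n s s = real n" by (simp add: ip_self)
  have "ip n s (mv n (\<lambda>i j. B $$ (i, j)) s) = ip n s (\<lambda>i. \<gamma> * real n * s i + mv n W s i)"
    by (rule ip_cong) (simp_all add: mvB ss)
  also have "\<dots> = \<gamma> * real n * real n + ip n s (mv n W s)"
    by (simp add: ip_add_right ip_scale_right ss)
  also have "\<dots> \<ge> \<gamma> * real n * real n - \<rho> * real n"
  proof -
    have "\<bar>ip n s (mv n W s)\<bar> \<le> \<rho> * nrm n s * nrm n s" using bd unfolding form_bounded_def by blast
    also have "\<dots> = \<rho> * real n" by (simp add: ns mult.assoc)
    finally show ?thesis by linarith
  qed
  finally have "l * real n \<le> ip n s (mv n (\<lambda>i j. B $$ (i, j)) s)" by (simp add: l(1) algebra_simps)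
  also have "\<dots> \<le> lam * real n"
    using rayleigh_le_largest_eigenvalue[OF B n symB, of s] by (simp add: ss lam_def)
  finally have lam: "l \<le> lam" using n by simp
  have eig: "lam * v i - mv n W v i = \<gamma> * ip n s v * s i" if "i < n" for i
  proof -
    have "lam * v i = (B *\<^sub>v u) $ i" using u that by (simp add: v_def)
    also have "\<dots> = mv n (\<lambda>i j. B $$ (i, j)) v i"
      using mult_mat_vec_eq_mv[OF B u(1) that] by (simp add: v_def[abs_def])
    finally show ?thesis using mvB[OF that, of v] by simp
  qed
  have unit: "ip n v v = 1"
    using u by (simp add: ip_def v_def scalar_prod_def atLeast0LessThan)
  have pos: "0 < \<gamma> * ip n s v * s i * v i" if "i < n" for i
  proof (rule eigenvector_signs[OF sym bd rho(1) _ _ s unit eig _ margin that])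
    show "4 * \<rho> \<le> lam" "0 < lam" using rho(2) lam l(2) by simp_all
    show "1 - \<theta> / l - 2 * b * \<rho> / l\<^sup>2
      \<le> 1 + s i * (\<Sum>k<n. ip n (off_diag_row W i) ((mv n (leave_out W i) ^^ k) s) / lam ^ Suc k)"
      if "i < n" for i
      using first[OF that] higher[OF that]
      by (intro row_series_lower_bound[OF n l(2) lam rho b th s[OF that]]) (simp_all add: s_def[abs_def])
  qed
  show ?thesis
    by (rule agreement_ratio_eq_1[OF n u(1) sig, of "\<gamma> * ip n s v"])
       (use pos in \<open>simp_all add: s_def v_def\<close>)
qed

lemma gaussian_noise_of_sbm:
  assumes sbm: "gaussian_sbm_diag P n \<mu>\<^sub>1 \<mu>\<^sub>2 \<tau> \<sigma> A" and n: "0 < n" and tau: "0 < \<tau>"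
  shows "gaussian_noise P n (\<lambda>p \<omega>. A \<omega> $$ p - (if \<sigma> $ fst p = \<sigma> $ snd p then \<mu>\<^sub>1 else \<mu>\<^sub>2)) \<tau>"
proof -
  interpret prob_space P using sbm by (simp add: gaussian_sbm_diag_def gaussian_sbm_def)
  let ?m = "\<lambda>p. if \<sigma> $ fst p = \<sigma> $ snd p then \<mu>\<^sub>1 else \<mu>\<^sub>2"
  have "indep_vars (\<lambda>_. borel) (\<lambda>(i, j) \<omega>. A \<omega> $$ (i, j)) (upper_pairs n)"
    using sbm by (simp add: gaussian_sbm_diag_def upper_pairs_def)
  then have "indep_vars (\<lambda>_. borel) (\<lambda>p \<omega>. A \<omega> $$ p) (upper_pairs n)" by (simp add: case_prod_beta')
  then have ind: "indep_vars (\<lambda>_. borel) (\<lambda>p \<omega>. A \<omega> $$ p - ?m p) (upper_pairs n)"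
    by (rule indep_vars_compose2) simp
  have "distributed P lborel (\<lambda>\<omega>. A \<omega> $$ p - ?m p) (\<lambda>x. ennreal (normal_density 0 \<tau> x))"
    if "p \<in> upper_pairs n" for p
  proof -
    obtain i j where p: "p = (i, j)" by (cases p)
    then have ij: "i \<le> j" "i < n" "j < n" using that by (auto simp: upper_pairs_def)
    have "distributed P lborel (\<lambda>\<omega>. A \<omega> $$ p) (\<lambda>x. ennreal (normal_density (?m p) \<tau> x))"
      using sbm ij unfolding gaussian_sbm_diag_def gaussian_sbm_def p by (cases "i = j") auto
    from normal_density_affine[OF this tau, of 1 "- ?m p"] show ?thesis by simp
  qed
  then show ?thesis using n tau ind by unfold_locales auto
qed

lemma recovery_event_measurable:
  assumes dim: "\<And>\<omega>. \<omega> \<in> space P \<Longrightarrow> u \<omega> \<in> carrier_vec n"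
    and meas: "\<And>i. i < n \<Longrightarrow> (\<lambda>\<omega>. u \<omega> $ i) \<in> borel_measurable P"
  shows "{\<omega> \<in> space P. agreement_ratio n (sign_vec (u \<omega>)) \<sigma> = 1} \<in> sets P"
proof -
  let ?f = "\<lambda>\<omega>. max (1 / real n * (\<Sum>i<n. if sgn (u \<omega> $ i) = \<sigma> $ i then 1 else 0))
         (1 / real n * (\<Sum>i<n. if - sgn (u \<omega> $ i) = \<sigma> $ i then 1 else 0))"
  have "agreement_ratio n (sign_vec (u \<omega>)) \<sigma> = ?f \<omega>" if "\<omega> \<in> space P" for \<omega>
    unfolding agreement_ratio_def
    by (intro arg_cong2[where f=max] arg_cong2[where f="(*)"] sum.cong)
       (use dim[OF that] in \<open>auto simp: sign_vec_def\<close>)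
  then have "{\<omega> \<in> space P. agreement_ratio n (sign_vec (u \<omega>)) \<sigma> = 1} = {\<omega> \<in> space P. ?f \<omega> = 1}"
    by auto
  also have "\<dots> \<in> sets P"
  proof -
    have "(\<lambda>\<omega>. if sgn (u \<omega> $ i) = c then 1 else 0 :: real) \<in> borel_measurable P"
      "(\<lambda>\<omega>. if - sgn (u \<omega> $ i) = c then 1 else 0 :: real) \<in> borel_measurable P" if "i < n" for i c
      using meas[OF that] by measurable
    then have "?f \<in> borel_measurable P"
      by (intro borel_measurable_max borel_measurable_times borel_measurable_const borel_measurable_sum) auto
    then show ?thesis by measurable
  qed
  finally show ?thesis .
qed

lemma recovery_probability_ge:
  assumes sbm: "gaussian_sbm_diag P n \<mu>\<^sub>1 \<mu>\<^sub>2 \<tau> \<sigma> A" and n: "0 < n" and tau: "0 < \<tau>"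
    and top: "\<And>\<omega>. \<omega> \<in> space P \<Longrightarrow> top_unit_eigenvector (centered_adjacency n \<mu>\<^sub>1 \<mu>\<^sub>2 (A \<omega>)) (u \<omega>)"
    and meas: "\<And>i. i < n \<Longrightarrow> (\<lambda>\<omega>. u \<omega> $ i) \<in> borel_measurable P"
    and rho: "\<rho> = 24 * \<tau> * sqrt n" and l: "l = (\<mu>\<^sub>1 - \<mu>\<^sub>2) / 2 * n - \<rho>" "0 < l" "4 * \<rho> \<le> l"
    and th: "0 \<le> \<theta>" and t: "0 \<le> t"
    and margin: "(1/4) ^ n * sqrt n < 1 - \<theta> / l - 2 * (t * \<tau> * sqrt n) * \<rho> / l\<^sup>2"
  shows "1 - (2 ^ (36 * n) * exp (- 36 * real n) + n * exp (- \<theta>\<^sup>2 / (2 * \<tau>\<^sup>2 * real n))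
            + 2 * (real n)\<^sup>2 * exp (- t\<^sup>2 / 2))
         \<le> measure P {\<omega> \<in> space P. agreement_ratio n (sign_vec (u \<omega>)) \<sigma> = 1}"
proof -
  let ?X = "\<lambda>p \<omega>. A \<omega> $$ p - (if \<sigma> $ fst p = \<sigma> $ snd p then \<mu>\<^sub>1 else \<mu>\<^sub>2)"
  interpret gaussian_noise P n ?X \<tau> by (rule gaussian_noise_of_sbm[OF sbm n tau])
  have sig: "\<sigma> $ i \<in> {1, -1}" if "i < n" for i
    using sbm that by (auto simp: gaussian_sbm_diag_def gaussian_sbm_def balanced_labelings_def)
  have A: "A \<omega> \<in> carrier_mat n n" "transpose_mat (A \<omega>) = A \<omega>" if "\<omega> \<in> space P" for \<omega>
    using sbm that by (auto simp: gaussian_sbm_diag_def gaussian_sbm_def)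
  have rho0: "0 \<le> \<rho>" using rho tau by simp
  obtain F where F: "F \<in> events"
    "prob F \<le> 2 ^ (36 * n) * exp (- 36 * real n) + n * exp (- \<theta>\<^sup>2 / (2 * \<tau>\<^sup>2 * real n))
       + 2 * (real n)\<^sup>2 * exp (- t\<^sup>2 / 2)"
    and bd: "\<And>\<omega>. \<omega> \<in> space P \<Longrightarrow> \<omega> \<notin> F \<Longrightarrow> form_bounded n (W \<omega>) \<rho>"
    and first: "\<And>\<omega> i. \<omega> \<in> space P \<Longrightarrow> \<omega> \<notin> F \<Longrightarrow> i < n \<Longrightarrow>
      - \<theta> \<le> \<sigma> $ i * ip n (off_diag_row (W \<omega>) i) (\<lambda>j. \<sigma> $ j)"
    and higher: "\<And>\<omega> i k. \<omega> \<in> space P \<Longrightarrow> \<omega> \<notin> F \<Longrightarrow> i < n \<Longrightarrow> k < n \<Longrightarrow>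
       \<bar>ip n (off_diag_row (W \<omega>) i) ((mv n (leave_out (W \<omega>) i) ^^ k) (\<lambda>j. \<sigma> $ j))\<bar>
         \<le> t * \<tau> * \<rho> ^ k * sqrt n"
    by (rule good_event[of "\<lambda>j. \<sigma> $ j", OF sig th t rho]) (assumption, rule that)
  let ?R = "{\<omega> \<in> space P. agreement_ratio n (sign_vec (u \<omega>)) \<sigma> = 1}"
  have "\<omega> \<in> ?R" if \<omega>: "\<omega> \<in> space P" "\<omega> \<notin> F" for \<omega>
  proof -
    let ?B = "centered_adjacency n \<mu>\<^sub>1 \<mu>\<^sub>2 (A \<omega>)"
    have spike: "?B $$ (i, j) = (\<mu>\<^sub>1 - \<mu>\<^sub>2) / 2 * \<sigma> $ i * \<sigma> $ j + W \<omega> i j" if ij: "i < n" "j < n" for i j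
    proof -
      have entry: "A \<omega> $$ (min i j, max i j) = A \<omega> $$ (i, j)"
        using A[OF \<omega>(1)] ij by (metis carrier_matD index_transpose_mat(1) max_def min_def)
      have label: "(\<sigma> $ min i j = \<sigma> $ max i j) = (\<sigma> $ i = \<sigma> $ j)"
        by (auto simp: min_def max_def)
      have mean: "(\<mu>\<^sub>1 - \<mu>\<^sub>2) / 2 * \<sigma> $ i * \<sigma> $ j
          = (if \<sigma> $ i = \<sigma> $ j then \<mu>\<^sub>1 else \<mu>\<^sub>2) - (\<mu>\<^sub>1 + \<mu>\<^sub>2) / 2"
        using sig[OF ij(1)] sig[OF ij(2)] by (auto simp: field_simps)
      show ?thesis
        unfolding centered_adjacency_entry[OF A(1)[OF \<omega>(1)] ij] W_def sym_ext_def fst_conv snd_conv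
          entry label mean
        by simp
    qed
    have "agreement_ratio n (sign_vec (u \<omega>)) \<sigma> = 1"
    proof (rule spiked_eigenvector_recovers[OF n centered_adjacency_carrier[OF A(1)[OF \<omega>(1)]] spike sig
        _ top[OF \<omega>(1)] bd[OF \<omega>] l(1,2) rho0 l(3) _ th first[OF \<omega>] _ margin])
      show "symmetric_below n (W \<omega>)" unfolding W_def by (rule symmetric_below_sym_ext)
      show "0 \<le> t * \<tau> * sqrt n" using t tau by simp
      show "\<bar>ip n (off_diag_row (W \<omega>) i) ((mv n (leave_out (W \<omega>) i) ^^ k) (\<lambda>j. \<sigma> $ j))\<bar>
        \<le> t * \<tau> * sqrt n * \<rho> ^ k" if "i < n" "k < n" for i k
        using higher[OF \<omega> that] by (simp add: mult_ac)
    qed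
    then show ?thesis using \<omega> by simp
  qed
  then have "space P - F \<subseteq> ?R" by blast
  moreover have "?R \<in> events"
  proof (rule recovery_event_measurable[OF _ meas])
    show "u \<omega> \<in> carrier_vec n" if "\<omega> \<in> space P" for \<omega>
      using top[OF that] centered_adjacency_carrier[OF A(1)[OF that], of \<mu>\<^sub>1 \<mu>\<^sub>2]
      unfolding top_unit_eigenvector_def eigenvector_def by (metis carrier_matD(1))
  qed
  ultimately have "prob (space P - F) \<le> prob ?R" by (rule finite_measure_mono)
  then show ?thesis using F prob_compl[OF F(1)] by linarith
qed

section \<open>Asymptotics\<close>

text \<open>
  The separation \<open>n \<gamma> = \<kappa> \<surd>(n ln n)\<close> beats the noise norm \<open>\<rho> = 24 \<tau> \<surd>n\<close> by the factor
  \<open>\<surd>(ln n)\<close>. The second limit is the relative loss in a row: \<open>\<delta>\<close> from the first-order term and a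
  vanishing part from the higher ones.
\<close>

lemma threshold_limits:
  fixes \<kappa> \<tau> \<delta> :: real
  assumes "0 < \<kappa>" "0 < \<tau>"
  defines "sep \<equiv> \<lambda>n::nat. \<kappa> * sqrt (ln n / n) * n"
  defines "\<rho> \<equiv> \<lambda>n::nat. 24 * \<tau> * sqrt n"
  shows "eventually (\<lambda>n. 0 < sep n - \<rho> n \<and> 4 * \<rho> n \<le> sep n - \<rho> n) sequentially"
    and "((\<lambda>n. \<delta> * sep n / (sep n - \<rho> n)
           + 2 * (3 * sqrt (ln n) * \<tau> * sqrt n) * \<rho> n / (sep n - \<rho> n)\<^sup>2) \<longlongrightarrow> \<delta>) sequentially"
    and "((\<lambda>n::nat. (1/4) ^ n * sqrt n) \<longlongrightarrow> 0) sequentially"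
proof -
  have "eventually (\<lambda>n. 0 < sep n - \<rho> n) sequentially"
    unfolding sep_def \<rho>_def using assms(1,2) by real_asymp
  moreover have "eventually (\<lambda>n. 4 * \<rho> n \<le> sep n - \<rho> n) sequentially"
    unfolding sep_def \<rho>_def using assms(1,2) by real_asymp
  ultimately show "eventually (\<lambda>n. 0 < sep n - \<rho> n \<and> 4 * \<rho> n \<le> sep n - \<rho> n) sequentially"
    by eventually_elim simp
  have "((\<lambda>n. sep n / (sep n - \<rho> n)) \<longlongrightarrow> 1) sequentially"
    unfolding sep_def \<rho>_def using assms(1,2) by real_asymp
  moreover have "((\<lambda>n. 2 * (3 * sqrt (ln n) * \<tau> * sqrt n) * \<rho> n / (sep n - \<rho> n)\<^sup>2) \<longlongrightarrow> 0) sequentially"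
    unfolding sep_def \<rho>_def using assms(1,2) by real_asymp
  ultimately have "((\<lambda>n. \<delta> * (sep n / (sep n - \<rho> n))
           + 2 * (3 * sqrt (ln n) * \<tau> * sqrt n) * \<rho> n / (sep n - \<rho> n)\<^sup>2) \<longlongrightarrow> \<delta> * 1 + 0) sequentially"
    by (intro tendsto_intros)
  then show "((\<lambda>n. \<delta> * sep n / (sep n - \<rho> n)
           + 2 * (3 * sqrt (ln n) * \<tau> * sqrt n) * \<rho> n / (sep n - \<rho> n)\<^sup>2) \<longlongrightarrow> \<delta>) sequentially"
    by simp
  show "((\<lambda>n::nat. (1/4) ^ n * sqrt n) \<longlongrightarrow> 0) sequentially" by real_asymp
qed

text \<open>
  The middle term is \<open>n\<close> to the power \<open>1 - \<delta>\<^sup>2 * SNR\<close>; it is the only one in which the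
  signal-to-noise ratio appears.
\<close>

lemma failure_probability_limit:
  fixes \<kappa> \<tau> \<delta> :: real
  assumes "0 < \<kappa>" "0 < \<tau>" and SNR: "1 < \<delta>\<^sup>2 * (\<kappa>\<^sup>2 / (2 * \<tau>\<^sup>2))"
  shows "((\<lambda>n::nat. 2 ^ (36 * n) * exp (- 36 * real n)
      + n * exp (- (\<delta> * (\<kappa> * sqrt (ln n / n) * n))\<^sup>2 / (2 * \<tau>\<^sup>2 * real n))
      + 2 * (real n)\<^sup>2 * exp (- (3 * sqrt (ln n))\<^sup>2 / 2)) \<longlongrightarrow> 0) sequentially"
proof -
  define s where "s = \<delta>\<^sup>2 * (\<kappa>\<^sup>2 / (2 * \<tau>\<^sup>2))"
  have s: "1 < s" using SNR by (simp add: s_def)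
  have l1: "(\<lambda>n::nat. 2 ^ (36 * n) * exp (- 36 * real n)) \<longlonglongrightarrow> 0"
  proof -
    \<comment> \<open>\<open>exp 1 > 2\<close>, from \<open>1 + x \<le> exp x\<close> at \<open>x = 1/2\<close>\<close>
    have "2 < (1 + 1/2 :: real)\<^sup>2" by (simp add: power2_eq_square)
    also have "\<dots> \<le> (exp (1/2))\<^sup>2" using exp_ge_add_one_self[of "1/2"] by (intro power_mono) auto
    also have "\<dots> = exp (1::real)" by (simp flip: exp_of_nat_mult)
    finally have e: "2 * exp (-1 :: real) < 1" by (simp add: exp_minus field_simps)
    have "((2 * exp (-1::real)) ^ 36) ^ n = 2 ^ (36 * n) * exp (- 36 * real n)" for n :: nat
      unfolding power_mult[symmetric] power_mult_distrib by (simp flip: exp_of_nat_mult)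
    moreover have "(\<lambda>n::nat. ((2 * exp (-1::real)) ^ 36) ^ n) \<longlonglongrightarrow> 0"
      using e power_Suc_less_one[of "2 * exp (-1::real)" 35]
      by (intro LIMSEQ_realpow_zero) auto
    ultimately show ?thesis by (simp only:)
  qed
  have "eventually (\<lambda>n::nat. n * exp (- (\<delta> * (\<kappa> * sqrt (ln n / n) * n))\<^sup>2 / (2 * \<tau>\<^sup>2 * real n))
      = real n * exp (- s * ln n)) sequentially"
    using eventually_ge_at_top[of 1]
  proof eventually_elim
    case (elim n)
    then have "(sqrt (ln n / n))\<^sup>2 = ln n / n" by simp
    then have "- (\<delta> * (\<kappa> * sqrt (ln n / n) * n))\<^sup>2 / (2 * \<tau>\<^sup>2 * real n) = - s * ln n"
      using elim assms unfolding power_mult_distrib s_def by (simp add: field_simps power2_eq_square)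
    then show ?case by simp
  qed
  moreover have "(\<lambda>n::nat. real n * exp (- s * ln n)) \<longlonglongrightarrow> 0"
    using s by real_asymp
  ultimately have l2: "(\<lambda>n::nat. n * exp (- (\<delta> * (\<kappa> * sqrt (ln n / n) * n))\<^sup>2 / (2 * \<tau>\<^sup>2 * real n))) \<longlonglongrightarrow> 0"
    by (rule tendsto_cong[THEN iffD2])
  have l3: "(\<lambda>n::nat. 2 * (real n)\<^sup>2 * exp (- (3 * sqrt (ln n))\<^sup>2 / 2)) \<longlonglongrightarrow> 0"
  proof (rule tendsto_cong[THEN iffD2])
    show "eventually (\<lambda>n::nat. 2 * (real n)\<^sup>2 * exp (- (3 * sqrt (ln n))\<^sup>2 / 2)
        = 2 * (real n)\<^sup>2 * exp (- (9/2) * ln n)) sequentially"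
      using eventually_ge_at_top[of 1] by eventually_elim (simp add: power_mult_distrib)
    show "(\<lambda>n::nat. 2 * (real n)\<^sup>2 * exp (- (9/2) * ln n)) \<longlonglongrightarrow> 0" by real_asymp
  qed
  show ?thesis using tendsto_add[OF tendsto_add[OF l1 l2] l3] by simp
qed

section \<open>Exact recovery above the threshold\<close>

theorem theorem15:
  fixes \<alpha> \<beta> \<tau> :: real
    and P :: "nat \<Rightarrow> 'a measure"
    and \<sigma> :: "nat \<Rightarrow> real vec"
    and A :: "nat \<Rightarrow> 'a \<Rightarrow> real mat"
    and u :: "nat \<Rightarrow> 'a \<Rightarrow> real vec"
  assumes "\<alpha> > \<beta>" and "\<tau> > 0"
    and sbm: "\<And>n. even n \<Longrightarrow> n > 0 \<Longrightarrow>
      gaussian_sbm_diag (P n) n (edge_mean \<alpha> n) (edge_mean \<beta> n) \<tau> (\<sigma> n) (A n)"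
    and top: "\<And>n \<omega>. even n \<Longrightarrow> n > 0 \<Longrightarrow> \<omega> \<in> space (P n) \<Longrightarrow>
      top_unit_eigenvector
        (centered_adjacency n (edge_mean \<alpha> n) (edge_mean \<beta> n) (A n \<omega>)) (u n \<omega>)"
    and random_vector: "\<And>n i. even n \<Longrightarrow> n > 0 \<Longrightarrow> i < n \<Longrightarrow>
      (\<lambda>\<omega>. u n \<omega> $ i) \<in> borel_measurable (P n)"
    and SNR: "(\<alpha> - \<beta>)\<^sup>2 / (8 * \<tau>\<^sup>2) > 1"
  shows "((\<lambda>n. measure (P n)
             {\<omega> \<in> space (P n). agreement_ratio n (sign_vec (u n \<omega>)) (\<sigma> n) = 1})
           \<longlongrightarrow> 1) (inf sequentially (principal {n. even n}))"
proof -
  define \<kappa> where "\<kappa> = (\<alpha> - \<beta>) / 2"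
  have kappa: "0 < \<kappa>" using assms(1) by (simp add: \<kappa>_def)
  define S where "S = \<kappa>\<^sup>2 / (2 * \<tau>\<^sup>2)"
  have S: "1 < S" using SNR by (simp add: S_def \<kappa>_def power_divide)
  \<comment> \<open>any \<open>\<delta>\<close> with \<open>1 / S < \<delta>\<^sup>2 < 1\<close> works: rows may lose the fraction \<open>\<delta>\<close> of the signal\<close>
  define \<delta> where "\<delta> = sqrt ((1 + 1 / S) / 2)"
  have delta_sq: "\<delta>\<^sup>2 = (1 + 1 / S) / 2" using S by (simp add: \<delta>_def)
  have delta: "0 \<le> \<delta>" "\<delta> < 1" using S by (simp_all add: \<delta>_def)
  have "1 < \<delta>\<^sup>2 * S" using S by (simp add: delta_sq field_simps)
  then have margin_SNR: "1 < \<delta>\<^sup>2 * (\<kappa>\<^sup>2 / (2 * \<tau>\<^sup>2))" by (simp add: S_def)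
  define sep where "sep n = \<kappa> * sqrt (ln n / n) * n" for n :: nat
  define \<rho> where "\<rho> n = 24 * \<tau> * sqrt n" for n :: nat
  define fail where "fail n = 2 ^ (36 * n) * exp (- 36 * real n)
      + n * exp (- (\<delta> * sep n)\<^sup>2 / (2 * \<tau>\<^sup>2 * real n))
      + 2 * (real n)\<^sup>2 * exp (- (3 * sqrt (ln n))\<^sup>2 / 2)" for n :: nat
  let ?R = "\<lambda>n. measure (P n) {\<omega> \<in> space (P n). agreement_ratio n (sign_vec (u n \<omega>)) (\<sigma> n) = 1}"
  let ?F = "inf sequentially (principal {n::nat. even n})"
  note limits = threshold_limits[OF kappa assms(2), folded sep_def \<rho>_def]
  have "\<forall>\<^sub>F n in sequentially. \<delta> * sep n / (sep n - \<rho> n)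
      + 2 * (3 * sqrt (ln n) * \<tau> * sqrt n) * \<rho> n / (sep n - \<rho> n)\<^sup>2 < (1 + \<delta>) / 2"
    using limits(2) delta by (intro order_tendstoD(2)) auto
  moreover have "\<forall>\<^sub>F n::nat in sequentially. (1/4) ^ n * sqrt n < (1 - \<delta>) / 2"
    using limits(3) delta by (intro order_tendstoD(2)) auto
  ultimately have "\<forall>\<^sub>F n in sequentially. even n \<longrightarrow> 1 - fail n \<le> ?R n"
    using limits(1) eventually_ge_at_top[of 1]
  proof eventually_elim
    case (elim n)
    show ?case
    proof
      assume even: "even n"
      have n: "0 < n" using elim by simp
      have gap: "(edge_mean \<alpha> n - edge_mean \<beta> n) / 2 * real n = sep n"
        by (simp add: edge_mean_def sep_def \<kappa>_def field_simps)
      have sep: "0 \<le> sep n" using kappa n by (simp add: sep_def)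
      show "1 - fail n \<le> ?R n"
        unfolding fail_def
      proof (rule recovery_probability_ge[OF sbm[OF even n] n assms(2) top[OF even n]
            random_vector[OF even n] \<rho>_def])
        show "sep n - \<rho> n = (edge_mean \<alpha> n - edge_mean \<beta> n) / 2 * real n - \<rho> n" by (simp only: gap)
        show "0 \<le> \<delta> * sep n" using sep delta by simp
        \<comment> \<open>three square roots of \<open>ln n\<close> give failure probability \<open>n\<close> to the power \<open>- 9 / 2\<close>, enough for \<open>n\<^sup>2\<close> events\<close>
        show "0 \<le> 3 * sqrt (ln n)" using n by simp
        show "(1/4) ^ n * sqrt n < 1 - \<delta> * sep n / (sep n - \<rho> n)
            - 2 * (3 * sqrt (ln n) * \<tau> * sqrt n) * \<rho> n / (sep n - \<rho> n)\<^sup>2"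
          using elim(1,2) by argo
      qed (use elim(3) in auto)
    qed
  qed
  then have lower: "\<forall>\<^sub>F n in ?F. 1 - fail n \<le> ?R n"
    by (simp add: eventually_inf_principal)
  have "\<forall>\<^sub>F n in sequentially. even n \<longrightarrow> ?R n \<le> 1"
    using eventually_gt_at_top[of 0]
  proof eventually_elim
    case (elim n)
    then show ?case
      using sbm[of n] by (auto simp: gaussian_sbm_diag_def gaussian_sbm_def intro: prob_space.prob_le_1)
  qed
  then have upper: "\<forall>\<^sub>F n in ?F. ?R n \<le> 1" by (simp add: eventually_inf_principal)
  have "fail \<longlonglongrightarrow> 0"
    using failure_probability_limit[OF kappa assms(2) margin_SNR]
    unfolding fail_def[abs_def] sep_def .
  then have "((\<lambda>n. 1 - fail n) \<longlongrightarrow> 1 - 0) ?F"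
    by (intro tendsto_intros tendsto_mono[OF inf_le1])
  then show ?thesis
    using tendsto_sandwich[OF lower upper] by simp
qed

end
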